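(* Let $X$ be a compact metrizable space with metric $d$ and let $T:X\to X$ be a continuous surjective map. Then $$\overline{\mathrm{mdim}}_M(T,X,d)=\limsup_{\delta\to 0}\frac{1}{\log\frac1\delta}\sup_{x\in X}h_{\mathrm{top}}(T,W^s(x,T),d,\delta).$$
   Context: Stable set: $W^s(x,T)=\{y\in X:\lim_{n\to\infty}d(T^nx,T^ny)=0\}$. With $d_n(x,y)=\max_{0\le j\le n-1}d(T^jx,T^jy)$, for non-empty $Z\subset X$ let $r_n(T,Z,d,\epsilon)$ be the smallest cardinality of a set $E\subset X$ such that every $x\in Z$ has some $y\in E$ with $d_n(x,y)<\epsilon$. Put $h_{\mathrm{top}}(T,Z,d,\epsilon)=\limsup_{n\to\infty}\frac1n\log r_n(T,Z,d,\epsilon)$ and $\overline{\mathrm{mdim}}_M(T,Z,d)=\limsup_{\epsilon\to0}\frac{h_{\mathrm{top}}(T,Z,d,\epsilon)}{\log\frac1\epsilon}$. *)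

theory Defs
  imports "HOL-Analysis.Analysis"
begin

(* A compact metric space (X, d) is a compact set X in a type of class metric_space, with d the
   metric dist of that type.  Maps are total functions on the type; only their values on X
   matter, as X is always invariant. *)

definition stable_set :: "'a::metric_space set \<Rightarrow> ('a \<Rightarrow> 'a) \<Rightarrow> 'a \<Rightarrow> 'a set" where
  "stable_set X T x = {y \<in> X. (\<lambda>n. dist ((T ^^ n) x) ((T ^^ n) y)) \<longlonglongrightarrow> 0}"

(* Meaningful for n >= 1; the value at n = 0 is unspecified and does not affect the upper limit
   as n tends to infinity below. *)
definition bowen_dist :: "('a::metric_space \<Rightarrow> 'a) \<Rightarrow> nat \<Rightarrow> 'a \<Rightarrow> 'a \<Rightarrow> real" where
  "bowen_dist T n x y = Max ((\<lambda>j. dist ((T ^^ j) x) ((T ^^ j) y)) ` {0..<n})"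

definition spanning :: "'a::metric_space set \<Rightarrow> ('a \<Rightarrow> 'a) \<Rightarrow> 'a set \<Rightarrow> nat \<Rightarrow> real \<Rightarrow> 'a set \<Rightarrow> bool" where
  "spanning X T Z n \<epsilon> E \<longleftrightarrow> E \<subseteq> X \<and> (\<forall>x\<in>Z. \<exists>y\<in>E. bowen_dist T n x y < \<epsilon>)"

(* The centres E lie in X, not necessarily in Z.  For compact X, continuous T, n >= 1 and
   \<epsilon> > 0 a finite spanning set exists, so the minimum is attained. *)
definition spanning_number :: "'a::metric_space set \<Rightarrow> ('a \<Rightarrow> 'a) \<Rightarrow> 'a set \<Rightarrow> nat \<Rightarrow> real \<Rightarrow> nat" where
  "spanning_number X T Z n \<epsilon> = (LEAST k. \<exists>E. finite E \<and> card E = k \<and> spanning X T Z n \<epsilon> E)"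

definition h_top :: "'a::metric_space set \<Rightarrow> ('a \<Rightarrow> 'a) \<Rightarrow> 'a set \<Rightarrow> real \<Rightarrow> ereal" where
  "h_top X T Z \<epsilon> = limsup (\<lambda>n. ereal (ln (real (spanning_number X T Z n \<epsilon>)) / real n))"

definition upper_mdim :: "'a::metric_space set \<Rightarrow> ('a \<Rightarrow> 'a) \<Rightarrow> 'a set \<Rightarrow> ereal" where
  "upper_mdim X T Z = Limsup (at_right 0) (\<lambda>\<epsilon>. h_top X T Z \<epsilon> / ereal (ln (1 / \<epsilon>)))"

end

theory Submission
  imports Defs
begin

text \<open>
  A stable set is contained in the whole space, so only one inequality needs work: the entropy of
  \<open>X\<close> at scale \<open>\<epsilon>\<close> is at most the supremum over \<open>x\<close> of the entropies of
  \<open>W\<^sup>s(x)\<close> at scale \<open>\<epsilon>/4\<close>; the factor 4 disappears after division by \<open>ln (1/\<epsilon>)\<close>.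

  Suppose \<open>a < b\<close> and the entropy of \<open>X\<close> at scale \<open>\<epsilon>\<close> exceeds \<open>b\<close>. A cluster
  point of the empirical measures of large separated sets is a finitely additive invariant
  probability \<open>m\<close> on all subsets for which every finite partition into sets of \<open>d\<^sub>n\<close>-diameter
  less than \<open>\<epsilon>\<close> has entropy at least \<open>n b\<close>. Take finite codes \<open>q\<^sub>i\<close> of mesh
  \<open>\<delta>\<^sub>i \<rightarrow> 0\<close> and observe the level \<open>i\<close> only from a time \<open>n\<^sub>i\<close> on. If the \<open>n\<^sub>i\<close> grow
  suitably, the code of level 0 on \<open>[0, n\<^sub>k)\<close> is almost independent of all observations
  from time \<open>n\<^sub>k\<close> on, and two points with the same observations at all levels are
  asymptotic. If the fibers of these observations were covered by \<open>exp (n\<^sub>k a)\<close> Bowen balls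
  for most points, then by almost independence few fibers would already cover most of the space,
  giving a partition of entropy below \<open>n\<^sub>k b\<close>. So for every \<open>k\<close> the fibers of a set of
  points of mass at least \<open>c\<close> are not covered, where \<open>c > 0\<close> does not depend on \<open>k\<close>, and a reverse
  Fatou argument gives a point for which this happens for infinitely many \<open>k\<close>.
\<close>

section \<open>Entropy of finitely additive probabilities\<close>

text \<open>Finite additivity on all subsets suffices for entropy, asks for no measurability, and
  survives pointwise limits of set functions, so limits of empirical measures exist by
  Tychonoff.\<close>

locale fa_prob =
  fixes m :: "'a set \<Rightarrow> real"
  assumes nonneg: "0 \<le> m A"
    and total: "m UNIV = 1"
    and additive: "A \<inter> B = {} \<Longrightarrow> m (A \<union> B) = m A + m B"

text \<open>Shannon entropy of the partition into level sets; null cells contribute 0. It is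
  meaningful only for finite \<open>range f\<close>, because a sum over an infinite set is
  0.\<close>

definition ent :: "('a set \<Rightarrow> real) \<Rightarrow> ('a \<Rightarrow> 'b) \<Rightarrow> real" where
  "ent m f = - (\<Sum>v\<in>range f. m (f -` {v}) * ln (m (f -` {v})))"

text \<open>Sum the inequality \<open>ln t \<le> t - 1\<close> at \<open>t = r i / p i\<close> with
  weights \<open>p i\<close>.\<close>

lemma gibbs_inequality:
  fixes p r :: "'i \<Rightarrow> real"
  assumes "finite I" and p: "\<And>i. i \<in> I \<Longrightarrow> 0 \<le> p i" and "sum p I = 1"
    and r: "\<And>i. i \<in> I \<Longrightarrow> 0 \<le> r i" and "sum r I \<le> 1"
    and pos: "\<And>i. i \<in> I \<Longrightarrow> 0 < p i \<Longrightarrow> 0 < r i"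
  shows "(\<Sum>i\<in>I. p i * ln (r i)) \<le> (\<Sum>i\<in>I. p i * ln (p i))"
proof -
  have "p i * ln (r i) - p i * ln (p i) \<le> r i - p i" if "i \<in> I" for i
  proof (cases "p i = 0")
    case True
    then show ?thesis using r[OF that] by simp
  next
    case False
    then have a: "0 < p i" "0 < r i" using p[OF that] pos[OF that] by auto
    have "ln (r i / p i) \<le> r i / p i - 1"
      using a by (intro ln_le_minus_one) auto
    then have "p i * ln (r i / p i) \<le> p i * (r i / p i - 1)"
      using a by (intro mult_left_mono) auto
    then show ?thesis using a by (simp add: ln_div algebra_simps)
  qed
  then have "(\<Sum>i\<in>I. p i * ln (r i) - p i * ln (p i)) \<le> (\<Sum>i\<in>I. r i - p i)"
    by (rule sum_mono)
  then show ?thesis using assms by (simp add: sum_subtractf)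
qed

context fa_prob
begin

section \<open>Calculus of finitely additive probabilities\<close>

lemma empty: "m {} = 0"
  using additive[of "{}" "{}"] by simp

lemma mono: "A \<subseteq> B \<Longrightarrow> m A \<le> m B"
  using additive[of A "B - A"] nonneg[of "B - A"]
  by (simp add: Un_absorb1)

lemma le_one: "m A \<le> 1"
  using mono[of A UNIV] total by simp

lemma diff: "A \<subseteq> B \<Longrightarrow> m (B - A) = m B - m A"
  using additive[of A "B - A"] by (simp add: Un_absorb1)

lemma compl: "m (- A) = 1 - m A"
  using diff[of A UNIV] total by (simp add: Compl_eq_Diff_UNIV)

lemma subadditive: "m (A \<union> B) \<le> m A + m B"
proof -
  have "m (A \<union> (B - A)) = m A + m (B - A)" by (rule additive) auto
  moreover have "m (B - A) \<le> m B" by (rule mono) auto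
  ultimately show ?thesis by simp
qed

lemma finite_subadditive: "finite I \<Longrightarrow> m (\<Union>i\<in>I. A i) \<le> (\<Sum>i\<in>I. m (A i))"
proof (induction I rule: finite_induct)
  case (insert i I)
  then show ?case using subadditive[of "A i" "\<Union>i\<in>I. A i"] by simp
qed (simp add: empty)

lemma finite_additive:
  "finite I \<Longrightarrow> disjoint_family_on A I \<Longrightarrow> m (\<Union>i\<in>I. A i) = (\<Sum>i\<in>I. m (A i))"
proof (induction I rule: finite_induct)
  case (insert i I)
  have "m (A i \<union> (\<Union>i\<in>I. A i)) = m (A i) + m (\<Union>i\<in>I. A i)"
    using insert.hyps insert.prems by (intro additive) (auto simp: disjoint_family_on_def)
  then show ?case using insert by (simp add: disjoint_family_on_insert)
qed (simp add: empty)

lemma vimage_sum: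
  assumes "finite (range f)"
  shows "m (f -` B) = (\<Sum>v\<in>range f \<inter> B. m (f -` {v}))"
proof -
  have "f -` B = (\<Union>v\<in>range f \<inter> B. f -` {v})" by auto
  then show ?thesis
    using assms finite_additive[of "range f \<inter> B" "\<lambda>v. f -` {v}"]
    by (auto simp: disjoint_family_on_def)
qed

lemma sum_law: "finite (range f) \<Longrightarrow> (\<Sum>v\<in>range f. m (f -` {v})) = 1"
  using vimage_sum[of f UNIV] total by simp

lemma law_pos_imp_range: "0 < m (f -` {v}) \<Longrightarrow> v \<in> range f"
  using empty by (cases "f -` {v} = {}") auto

text \<open>Change of variables: means of functions of the coarser \<open>g\<close> are computed
  over the atoms of \<open>F\<close>. This brings the entropies of all marginals of a joint law over
  one index set.\<close>

lemma sum_law_factor: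
  assumes fin: "finite (range F)" and g: "g = \<pi> \<circ> F"
  shows "(\<Sum>w\<in>range F. m (F -` {w}) * \<phi> (\<pi> w)) = (\<Sum>v\<in>range g. m (g -` {v}) * \<phi> v)"
proof -
  have gr: "range g = \<pi> ` range F" using g by auto
  have "(\<Sum>w\<in>range F. m (F -` {w}) * \<phi> (\<pi> w))
      = (\<Sum>v\<in>range g. \<Sum>w\<in>{w \<in> range F. \<pi> w = v}. m (F -` {w}) * \<phi> (\<pi> w))"
    using fin unfolding gr by (rule sum.image_gen)
  also have "\<dots> = (\<Sum>v\<in>range g. m (g -` {v}) * \<phi> v)"
  proof (rule sum.cong[OF refl])
    fix v
    have "g -` {v} = F -` {w. \<pi> w = v}" using g by auto
    then have "m (g -` {v}) = (\<Sum>w\<in>{w \<in> range F. \<pi> w = v}. m (F -` {w}))"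
      using vimage_sum[OF fin, of "{w. \<pi> w = v}"] by (simp add: Int_def)
    then show "(\<Sum>w\<in>{w \<in> range F. \<pi> w = v}. m (F -` {w}) * \<phi> (\<pi> w)) = m (g -` {v}) * \<phi> v"
      by (simp add: sum_distrib_right)
  qed
  finally show ?thesis .
qed

section \<open>Entropy inequalities for functions with finite range\<close>

lemma ent_factor:
  assumes "finite (range F)" and "g = \<pi> \<circ> F"
  shows "ent m g = - (\<Sum>w\<in>range F. m (F -` {w}) * ln (m (g -` {\<pi> w})))"
  using sum_law_factor[OF assms, of "\<lambda>v. ln (m (g -` {v}))"] by (simp add: ent_def)

lemma law_le_factor: "g = \<pi> \<circ> F \<Longrightarrow> m (F -` {w}) \<le> m (g -` {\<pi> w})"
  by (rule mono) auto

text \<open>An atom of \<open>F\<close> lies inside an atom of \<open>g\<close>, so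
  \<open>- ln\<close> of its mass can only be larger.\<close>

lemma ent_mono:
  assumes fin: "finite (range F)" and det: "\<And>x y. F x = F y \<Longrightarrow> g x = g y"
  shows "ent m g \<le> ent m F"
proof -
  define \<pi> where "\<pi> w = g (SOME x. F x = w)" for w
  have g: "g = \<pi> \<circ> F"
    unfolding \<pi>_def by (auto intro!: ext det) (metis (mono_tags, lifting) someI)
  have "m (F -` {w}) * ln (m (F -` {w})) \<le> m (F -` {w}) * ln (m (g -` {\<pi> w}))" for w
  proof (cases "m (F -` {w}) = 0")
    case False
    then have "0 < m (F -` {w})" using nonneg[of "F -` {w}"] by simp
    then show ?thesis using law_le_factor[OF g, of w] by (intro mult_left_mono) auto
  qed simp
  then show ?thesis
    unfolding ent_factor[OF fin g] by (simp add: ent_def sum_mono)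
qed

lemma ent_cong:
  assumes "finite (range F)" "finite (range g)" and "\<And>x y. F x = F y \<longleftrightarrow> g x = g y"
  shows "ent m g = ent m F"
  using assms by (intro antisym ent_mono) auto

text \<open>Coding bound: hand-picked weights estimate an entropy from above without knowledge of
  the law.\<close>

lemma ent_le_cross_entropy:
  assumes fin: "finite (range f)"
    and r: "\<And>v. v \<in> range f \<Longrightarrow> 0 < r v" and "sum r (range f) \<le> 1"
  shows "ent m f \<le> - (\<Sum>v\<in>range f. m (f -` {v}) * ln (r v))"
proof -
  have "(\<Sum>v\<in>range f. m (f -` {v}) * ln (r v)) \<le> (\<Sum>v\<in>range f. m (f -` {v}) * ln (m (f -` {v})))"
    using assms nonneg by (intro gibbs_inequality) (auto simp: sum_law less_imp_le)
  then show ?thesis by (simp add: ent_def)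
qed

text \<open>Gibbs inequality for the joint law against \<open>r\<close>, built from the marginals on
  \<open>(f, h)\<close> and \<open>(g, h)\<close> so that \<open>f\<close> and \<open>g\<close>
  become conditionally independent given \<open>h\<close>.\<close>

lemma ent_submodular:
  assumes f: "finite (range f)" and g: "finite (range g)" and h: "finite (range h)"
  shows "ent m (\<lambda>x. (f x, g x, h x)) + ent m h
       \<le> ent m (\<lambda>x. (f x, h x)) + ent m (\<lambda>x. (g x, h x))"
proof -
  define F where "F x = (f x, g x, h x)" for x
  define fh where "fh x = (f x, h x)" for x
  define gh where "gh x = (g x, h x)" for x
  define P where "P w = m (F -` {w})" for w
  define a where "a w = m (fh -` {w})" for w
  define b where "b w = m (gh -` {w})" for w
  define c where "c w = m (h -` {w})" for w
  define r where "r = (\<lambda>(u, v, w). a (u, w) * b (v, w) / c w)"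
  have sub: "range F \<subseteq> range f \<times> range g \<times> range h" by (auto simp: F_def)
  have fin: "finite (range F)" using f g h by (intro finite_subset[OF sub]) auto
  have fsub: "range fh \<subseteq> range f \<times> range h" by (auto simp: fh_def)
  have ffin: "finite (range fh)" using f h by (intro finite_subset[OF fsub]) auto
  have gsub: "range gh \<subseteq> range g \<times> range h" by (auto simp: gh_def)
  have gfin: "finite (range gh)" using g h by (intro finite_subset[OF gsub]) auto
  have e1: "fh = (\<lambda>w. (fst w, snd (snd w))) \<circ> F" by (auto simp: fh_def F_def)
  have e2: "gh = snd \<circ> F" by (auto simp: gh_def F_def)
  have e3: "h = (\<lambda>w. snd (snd w)) \<circ> F" by (auto simp: F_def)
  have suma: "(\<Sum>u\<in>range f. a (u, w)) = c w" for w
  proof -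
    have "h -` {w} = (\<Union>u\<in>range f. fh -` {(u, w)})" by (auto simp: fh_def)
    moreover have "disjoint_family_on (\<lambda>u. fh -` {(u, w)}) (range f)"
      by (auto simp: disjoint_family_on_def)
    ultimately show ?thesis using finite_additive[OF f, of "\<lambda>u. fh -` {(u, w)}"] unfolding c_def a_def by simp
  qed
  have sumb: "(\<Sum>u\<in>range g. b (u, w)) = c w" for w
  proof -
    have "h -` {w} = (\<Union>u\<in>range g. gh -` {(u, w)})" by (auto simp: gh_def)
    moreover have "disjoint_family_on (\<lambda>u. gh -` {(u, w)}) (range g)"
      by (auto simp: disjoint_family_on_def)
    ultimately show ?thesis using finite_additive[OF g, of "\<lambda>u. gh -` {(u, w)}"] unfolding c_def b_def by simp
  qed
  have r0: "0 \<le> r w" for w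
    by (auto simp: r_def a_def b_def c_def nonneg split: prod.splits)
  \<comment> \<open>On the full product the sum over \<open>u\<close> and \<open>v\<close> factors
    into \<open>c w * c w / c w\<close>, which is \<open>c w\<close> also when
    \<open>c w = 0\<close>.\<close>
  have "sum r (range F) \<le> sum r (range f \<times> range g \<times> range h)"
    using f g h sub r0 by (intro sum_mono2) auto
  also have "\<dots> = (\<Sum>u\<in>range f. \<Sum>v\<in>range g. \<Sum>w\<in>range h. a (u, w) * b (v, w) / c w)"
    by (simp add: sum.cartesian_product r_def)
  also have "\<dots> = (\<Sum>u\<in>range f. \<Sum>w\<in>range h. \<Sum>v\<in>range g. a (u, w) * b (v, w) / c w)"
    by (rule sum.cong[OF refl sum.swap])
  also have "\<dots> = (\<Sum>w\<in>range h. \<Sum>u\<in>range f. \<Sum>v\<in>range g. a (u, w) * b (v, w) / c w)"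
    by (rule sum.swap)
  also have "\<dots> = (\<Sum>w\<in>range h. (\<Sum>u\<in>range f. a (u, w)) * (\<Sum>v\<in>range g. b (v, w)) / c w)"
    by (simp add: sum_product sum_divide_distrib)
  also have "\<dots> = (\<Sum>w\<in>range h. c w)" by (simp add: suma sumb)
  also have "\<dots> = 1" using sum_law[OF h] by (simp add: c_def)
  finally have r1: "sum r (range F) \<le> 1" .
  have pos: "0 < a (u, w) \<and> 0 < b (v, w) \<and> 0 < c w" if "0 < P (u, v, w)" for u v w
    using that law_le_factor[OF e1, of "(u, v, w)"] law_le_factor[OF e2, of "(u, v, w)"]
      law_le_factor[OF e3, of "(u, v, w)"]
    by (simp add: P_def a_def b_def c_def)
  have P1: "sum P (range F) = 1" using sum_law[OF fin] by (simp add: P_def)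
  have P0: "0 \<le> P w" for w by (simp add: P_def nonneg)
  have "(\<Sum>w\<in>range F. P w * ln (r w)) \<le> (\<Sum>w\<in>range F. P w * ln (P w))"
  proof (rule gibbs_inequality[OF fin P0 P1 r0 r1])
    show "0 < r w" if "0 < P w" for w
      using that by (cases w) (auto simp: r_def dest: pos)
  qed
  also have "(\<Sum>w\<in>range F. P w * ln (r w)) =
      (\<Sum>w\<in>range F. P w * ln (a (fst w, snd (snd w)))
        + P w * ln (b (snd w)) - P w * ln (c (snd (snd w))))"
  proof (rule sum.cong[OF refl])
    fix w
    have nn: "0 \<le> P w" by (rule P0)
    obtain x y z where w: "w = (x, y, z)" by (cases w)
    show "P w * ln (r w) = P w * ln (a (fst w, snd (snd w)))
        + P w * ln (b (snd w)) - P w * ln (c (snd (snd w)))"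
    proof (cases "P w = 0")
      case False
      then have "0 < P (x, y, z)" using nn w by simp
      from pos[OF this] show ?thesis by (simp add: w r_def ln_div ln_mult algebra_simps)
    qed simp
  qed
  also have "\<dots> = - ent m fh - ent m gh + ent m h"
    unfolding ent_factor[OF fin e1] ent_factor[OF fin e2] ent_factor[OF fin e3]
    by (simp add: sum.distrib sum_subtractf P_def a_def b_def c_def)
  also have "(\<Sum>w\<in>range F. P w * ln (P w)) = - ent m F"
    by (simp add: ent_def P_def)
  finally show ?thesis unfolding F_def fh_def gh_def by simp
qed

lemma ent_nonneg: "0 \<le> ent m f"
proof -
  have "m (f -` {v}) * ln (m (f -` {v})) \<le> 0" for v
    using nonneg[of "f -` {v}"] le_one[of "f -` {v}"]
    by (cases "m (f -` {v}) = 0") (auto intro: mult_nonneg_nonpos)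
  then show ?thesis unfolding ent_def by (simp add: sum_nonpos)
qed

text \<open>
  The variational formula for the relative entropy of a joint law with respect to the product of
  its marginals, tested against \<open>l\<close> times an indicator function.
\<close>

lemma mutual_information_event:
  assumes f: "finite (range f)" and g: "finite (range g)" and l: "0 \<le> l"
    and small: "\<And>v. v \<in> V \<Longrightarrow> m (f -` W v) \<le> exp (- l)"
  shows "l * m {x. g x \<in> V \<and> f x \<in> W (g x)}
       \<le> ent m f + ent m g - ent m (\<lambda>x. (f x, g x)) + ln 2"
proof -
  define F where "F x = (f x, g x)" for x
  define A where "A = {(u, v). v \<in> V \<and> u \<in> W v}"
  define P where "P w = m (F -` {w})" for w
  define a where "a w = m (f -` {w})" for w
  define b where "b w = m (g -` {w})" for w
  define \<phi> where "\<phi> w = l * indicator A w" for w :: "'b \<times> 'c"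
  \<comment> \<open>Product of the marginals, tilted by
    \<open>exp (\<phi> w) \<le> 1 + exp l * indicator A w\<close>. Over a fixed value
    \<open>v\<close> of \<open>g\<close> the first summand has relative mass 1 and the second at
    most \<open>exp l * exp (- l) = 1\<close>, so halving makes \<open>r\<close> a subprobability;
    this is the source of \<open>ln 2\<close>.\<close>
  define r where "r = (\<lambda>w. a (fst w) * b (snd w) * exp (\<phi> w) / 2)"
  have sub: "range F \<subseteq> range f \<times> range g" by (auto simp: F_def)
  have fin: "finite (range F)" using f g by (intro finite_subset[OF sub]) auto
  have e1: "f = fst \<circ> F" by (auto simp: F_def)
  have e2: "g = snd \<circ> F" by (auto simp: F_def)
  have r0: "0 \<le> r w" for w by (simp add: r_def a_def b_def nonneg)
  have sa: "(\<Sum>u\<in>range f. a u) = 1" using sum_law[OF f] by (simp add: a_def)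
  have sb: "(\<Sum>u\<in>range g. b u) = 1" using sum_law[OF g] by (simp add: b_def)
  have inner: "(\<Sum>u\<in>range f. r (u, v)) \<le> b v" for v
  proof -
    have "(\<Sum>u\<in>range f. a u * exp (\<phi> (u, v)))
        \<le> (\<Sum>u\<in>range f. a u + exp l * (a u * indicator A (u, v)))"
      using l by (intro sum_mono) (auto simp: \<phi>_def a_def nonneg indicator_def)
    also have "\<dots> = 1 + exp l * (\<Sum>u\<in>range f. a u * indicator A (u, v))"
      by (simp add: sum.distrib sa sum_distrib_left)
    also have "\<dots> \<le> 2"
    proof (cases "v \<in> V")
      case True
      have "(\<Sum>u\<in>range f. a u * indicator A (u, v)) = (\<Sum>u\<in>range f \<inter> W v. a u)"
        using f True by (auto simp: A_def indicator_def sum.inter_restrict intro!: sum.cong)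
      also have "\<dots> \<le> exp (- l)" using small[OF True] vimage_sum[OF f, of "W v"] by (simp add: a_def)
      finally have "exp l * (\<Sum>u\<in>range f. a u * indicator A (u, v)) \<le> exp l * exp (- l)"
        by (intro mult_left_mono) auto
      then show ?thesis by (simp add: exp_minus)
    qed (simp add: A_def)
    finally have le: "(\<Sum>u\<in>range f. a u * exp (\<phi> (u, v))) \<le> 2" .
    have "(\<Sum>u\<in>range f. r (u, v)) = b v / 2 * (\<Sum>u\<in>range f. a u * exp (\<phi> (u, v)))"
      by (simp add: r_def sum_distrib_left algebra_simps)
    also have "\<dots> \<le> b v / 2 * 2" using le by (intro mult_left_mono) (auto simp: b_def nonneg)
    finally show ?thesis by simp
  qed
  have "sum r (range F) \<le> sum r (range f \<times> range g)"
    using f g sub r0 by (intro sum_mono2) auto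
  also have "\<dots> = (\<Sum>v\<in>range g. \<Sum>u\<in>range f. r (u, v))"
    by (subst sum.swap) (simp add: sum.cartesian_product)
  also have "\<dots> \<le> (\<Sum>v\<in>range g. b v)" by (rule sum_mono[OF inner])
  finally have r1: "sum r (range F) \<le> 1" using sb by simp
  have pos: "0 < a (fst w) \<and> 0 < b (snd w)" if "0 < P w" for w
    using that law_le_factor[OF e1, of w] law_le_factor[OF e2, of w]
    by (simp add: P_def a_def b_def)
  have P1: "sum P (range F) = 1" using sum_law[OF fin] by (simp add: P_def)
  have P0: "0 \<le> P w" for w by (simp add: P_def nonneg)
  have "(\<Sum>w\<in>range F. P w * ln (r w)) \<le> (\<Sum>w\<in>range F. P w * ln (P w))"
  proof (rule gibbs_inequality[OF fin P0 P1 r0 r1])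
    show "0 < r w" if "0 < P w" for w
      using pos[OF that] by (simp add: r_def)
  qed
  also have "(\<Sum>w\<in>range F. P w * ln (r w)) =
      (\<Sum>w\<in>range F. P w * ln (a (fst w)) + P w * ln (b (snd w)) + l * (P w * indicator A w) - P w * ln 2)"
  proof (rule sum.cong[OF refl])
    fix w
    show "P w * ln (r w) = P w * ln (a (fst w)) + P w * ln (b (snd w)) + l * (P w * indicator A w) - P w * ln 2"
    proof (cases "P w = 0")
      case False
      then have "0 < P w" using P0[of w] by simp
      from pos[OF this] show ?thesis by (simp add: r_def ln_div ln_mult algebra_simps \<phi>_def)
    qed simp
  qed
  also have "\<dots> = - ent m f - ent m g + l * (\<Sum>w\<in>range F. P w * indicator A w) - ln 2"
  proof -
    have "(\<Sum>w\<in>range F. P w * ln 2) = ln 2" using P1 by (simp add: sum_distrib_right[symmetric])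
    then show ?thesis
      unfolding ent_factor[OF fin e1] ent_factor[OF fin e2]
      by (simp add: sum.distrib sum_subtractf P_def a_def b_def sum_distrib_left)
  qed
  also have "(\<Sum>w\<in>range F. P w * indicator A w) = m {x. g x \<in> V \<and> f x \<in> W (g x)}"
  proof -
    have "{x. g x \<in> V \<and> f x \<in> W (g x)} = F -` A" by (auto simp: A_def F_def)
    then show ?thesis using vimage_sum[OF fin, of A] fin
      by (auto simp: P_def indicator_def sum.inter_restrict intro!: sum.cong)
  qed
  also have "(\<Sum>w\<in>range F. P w * ln (P w)) = - ent m F"
    by (simp add: ent_def P_def)
  finally show ?thesis unfolding F_def by simp
qed

end

text \<open>
  Greedy choice of the indices: each new set carries at least \<open>exp (- l)\<close> of unseen mass, so
  there are at most \<open>exp l\<close> of them.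
\<close>

lemma (in fa_prob) greedy_cover:
  fixes A :: "'v \<Rightarrow> 'a set"
  shows "\<exists>V'\<subseteq>V. finite V' \<and> real (card V') \<le> exp l \<and>
     (\<forall>v\<in>V. m (A v - (\<Union>u\<in>V'. A u)) \<le> exp (- l))"
proof (rule ccontr)
  assume neg: "\<not> ?thesis"
  have step: "\<exists>V'\<subseteq>V. finite V' \<and> card V' = k \<and> real k * exp (- l) \<le> m (\<Union>u\<in>V'. A u)" for k
  proof (induction k)
    case 0
    show ?case using nonneg by (intro exI[of _ "{}"]) auto
  next
    case (Suc k)
    then obtain V' where V': "V' \<subseteq> V" "finite V'" "card V' = k" "real k * exp (- l) \<le> m (\<Union>u\<in>V'. A u)"
      by blast
    have "real k * exp (- l) \<le> 1" using V'(4) le_one order_trans by blast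
    then have "real k \<le> exp l" by (simp add: exp_minus field_simps)
    then obtain v where v: "v \<in> V" "exp (- l) < m (A v - (\<Union>u\<in>V'. A u))"
      using neg V' by (auto simp: not_le)
    \<comment> \<open>An index already chosen has no unseen mass, so the cardinality really
      grows.\<close>
    have "v \<notin> V'"
    proof
      assume "v \<in> V'"
      then have "A v - (\<Union>u\<in>V'. A u) = {}" by auto
      then have "m (A v - (\<Union>u\<in>V'. A u)) = 0" using empty by metis
      then show False using v(2) by (simp add: not_less)
    qed
    moreover have "m ((\<Union>u\<in>V'. A u) \<union> (A v - (\<Union>u\<in>V'. A u))) = m (\<Union>u\<in>V'. A u) + m (A v - (\<Union>u\<in>V'. A u))"
      by (rule additive) auto
    moreover have "(\<Union>u\<in>V'. A u) \<union> (A v - (\<Union>u\<in>V'. A u)) = (\<Union>u\<in>insert v V'. A u)" by auto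
    ultimately show ?case using V' v
      by (intro exI[of _ "insert v V'"]) (auto simp: algebra_simps)
  qed
  obtain k :: nat where "exp l < real k" using reals_Archimedean2 by blast
  moreover from step[of k] have "real k * exp (- l) \<le> 1" using le_one order_trans by blast
  then have "real k \<le> exp l" by (simp add: exp_minus field_simps)
  ultimately show False by simp
qed

section \<open>Almost independence of past and future\<close>

definition tshift :: "nat \<Rightarrow> (nat \<times> nat) set \<Rightarrow> (nat \<times> nat) set" where
  "tshift s S = (\<lambda>(i, t). (i, t + s)) ` S"

text \<open>
  A pair \<open>(i, t)\<close> stands for the observation of the \<open>i\<close>-th code at time \<open>t\<close>.
\<close>

definition tail_window :: "(nat \<Rightarrow> nat) \<Rightarrow> nat \<Rightarrow> nat \<Rightarrow> nat \<Rightarrow> (nat \<times> nat) set" where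
  "tail_window n K k E = {(i, t). i \<le> K \<and> n i \<le> t \<and> n k \<le> t \<and> t < E}"

lemma finite_tshift [simp]: "finite S \<Longrightarrow> finite (tshift s S)"
  by (simp add: tshift_def)

lemma mem_tshift: "(i, t) \<in> tshift s S \<longleftrightarrow> s \<le> t \<and> (i, t - s) \<in> S"
  by (force simp: tshift_def image_iff)

lemma tshift_rect: "tshift s ({..k} \<times> {a..<b}) = {..k} \<times> {a + s..<b + s}"
  by (auto simp: mem_tshift)

lemma finite_tail_window [simp]: "finite (tail_window n K k E)"
  by (rule finite_subset[of _ "{..K} \<times> {..<E}"]) (auto simp: tail_window_def)

text \<open>\<open>h S\<close> stands for the entropy of the observations indexed by
  \<open>S\<close>. The independence estimate is carried out with these properties alone.\<close>

locale shift_polymatroid =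
  fixes h :: "(nat \<times> nat) set \<Rightarrow> real"
  assumes h_nonneg: "finite S \<Longrightarrow> 0 \<le> h S"
    and h_mono: "finite U \<Longrightarrow> S \<subseteq> U \<Longrightarrow> h S \<le> h U"
    and h_submodular: "finite S \<Longrightarrow> finite U \<Longrightarrow> h (S \<union> U) + h (S \<inter> U) \<le> h S + h U"
    and h_tshift: "finite S \<Longrightarrow> h (tshift s S) = h S"
begin

text \<open>Mutual information. The two index sets may overlap.\<close>

definition mi :: "(nat \<times> nat) set \<Rightarrow> (nat \<times> nat) set \<Rightarrow> real" where
  "mi A Y = h A + h Y - h (A \<union> Y)"

text \<open>Conditional entropy decreases under further conditioning: submodularity for
  \<open>A \<union> Y\<close> and \<open>Z\<close>, whose intersection contains
  \<open>Y\<close>.\<close>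

lemma diminishing_returns:
  assumes "finite A" "finite Z" "Y \<subseteq> Z"
  shows "h (A \<union> Z) - h Z \<le> h (A \<union> Y) - h Y"
proof -
  have fin: "finite Y" using assms finite_subset by blast
  have "h ((A \<union> Y) \<union> Z) + h ((A \<union> Y) \<inter> Z) \<le> h (A \<union> Y) + h Z"
    using assms fin by (intro h_submodular) auto
  moreover have "h Y \<le> h ((A \<union> Y) \<inter> Z)" using assms fin by (intro h_mono) auto
  moreover have "(A \<union> Y) \<union> Z = A \<union> Z" using assms by auto
  ultimately show ?thesis by simp
qed

lemma mi_mono_right:
  assumes "finite A" "finite Z" "Y \<subseteq> Z"
  shows "mi A Y \<le> mi A Z"
  using diminishing_returns[OF assms] by (simp add: mi_def)

lemma mi_commute: "mi A Y = mi Y A"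
  by (simp add: mi_def Un_commute)

lemma mi_mono:
  assumes "finite B" "finite Z" "A \<subseteq> B" "Y \<subseteq> Z"
  shows "mi A Y \<le> mi B Z"
proof -
  have fin: "finite A" using assms finite_subset by blast
  have "mi A Y \<le> mi A Z" using assms fin by (intro mi_mono_right)
  also have "\<dots> \<le> mi B Z" using assms mi_mono_right[of Z B A] by (simp add: mi_commute)
  finally show ?thesis .
qed

lemma mi_le: "finite A \<Longrightarrow> finite Y \<Longrightarrow> mi A Y \<le> h Y"
  using h_mono[of "A \<union> Y" A] by (simp add: mi_def)

text \<open>
  The union of the shifts \<open>A, A + n, \<dots>, A + (r - 1) n\<close> is built from right to left; each block
  adds at most as much as \<open>A\<close> adds to \<open>Y\<close>, because the part already present contains a shift
  of \<open>Y\<close>.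
\<close>

lemma block_sliding:
  assumes A: "finite A" and Y: "finite Y" and C: "finite C"
    and sub: "\<And>j. j < r \<Longrightarrow> tshift (j * n) Y \<subseteq> (\<Union>i\<in>{Suc j..<r}. tshift (i * n) A) \<union> C"
  shows "real r * mi A Y \<le> real r * h A - h (\<Union>i\<in>{0..<r}. tshift (i * n) A)
      + mi (\<Union>i\<in>{0..<r}. tshift (i * n) A) C"
proof -
  \<comment> \<open>The blocks from number \<open>j\<close> on; \<open>C\<close> hosts the parts of
    the shifted copies of \<open>Y\<close> that are not covered by later blocks.\<close>
  define B where "B j = (\<Union>i\<in>{j..<r}. tshift (i * n) A)" for j
  have finB: "finite (B j)" for j unfolding B_def using A by auto
  have step: "h (B j \<union> C) - h (B (Suc j) \<union> C) \<le> h (A \<union> Y) - h Y" if "j < r" for j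
  proof -
    have "{j..<r} = insert j {Suc j..<r}" using that by auto
    then have "B j = tshift (j * n) A \<union> B (Suc j)" unfolding B_def by simp
    then have "h (B j \<union> C) - h (B (Suc j) \<union> C)
      = h (tshift (j * n) A \<union> (B (Suc j) \<union> C)) - h (B (Suc j) \<union> C)"
      by (simp add: Un_assoc)
    also have "\<dots> \<le> h (tshift (j * n) A \<union> tshift (j * n) Y) - h (tshift (j * n) Y)"
      using sub[OF that] A C finB unfolding B_def[symmetric] by (intro diminishing_returns) auto
    also have "tshift (j * n) A \<union> tshift (j * n) Y = tshift (j * n) (A \<union> Y)"
      by (auto simp: tshift_def)
    finally show ?thesis using A Y by (simp add: h_tshift)
  qed
  have "h (B (r - j) \<union> C) - h C \<le> real j * (h (A \<union> Y) - h Y)" if "j \<le> r" for j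
    using that
  proof (induction j)
    case 0
    then show ?case by (simp add: B_def)
  next
    case (Suc j)
    then have "Suc (r - Suc j) = r - j" by simp
    then show ?case using step[of "r - Suc j"] Suc by (simp add: algebra_simps)
  qed
  from this[of r] have "h (B 0 \<union> C) - h C \<le> real r * (h (A \<union> Y) - h Y)" by simp
  then show ?thesis unfolding B_def[symmetric] mi_def by (simp add: algebra_simps)
qed

lemma union_blocks: "0 < n \<Longrightarrow> (\<Union>i\<in>{j..<r}. tshift (i * n) ({..k} \<times> {0..<n})) = {..k} \<times> {j * n..<r * n}"
proof (intro equalityI subsetI)
  fix p assume n: "0 < n" and p: "p \<in> {..k} \<times> {j * n..<r * n}"
  obtain i t where it: "p = (i, t)" by (cases p)
  have "j \<le> t div n" "t div n < r" using p n it
    by (auto simp: less_eq_div_iff_mult_less_eq div_less_iff_less_mult)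
  moreover have "t div n * n \<le> t" "t - t div n * n < n"
    using n by (auto simp: minus_div_mult_eq_mod)
  ultimately show "p \<in> (\<Union>i\<in>{j..<r}. tshift (i * n) ({..k} \<times> {0..<n}))"
    using p it by (auto simp: mem_tshift intro!: bexI[of _ "t div n"])
next
  fix p assume n: "0 < n" and p: "p \<in> (\<Union>i\<in>{j..<r}. tshift (i * n) ({..k} \<times> {0..<n}))"
  then obtain i where i: "j \<le> i" "i < r" "p \<in> {..k} \<times> {i * n..<n + i * n}"
    by (auto simp: tshift_rect)
  have "j * n \<le> i * n" "n + i * n \<le> r * n"
    using i mult_le_mono1[of j i n] mult_le_mono1[of "Suc i" r n] by auto
  then have "{i * n..<n + i * n} \<subseteq> {j * n..<r * n}" by (rule ivl_subset[THEN iffD2, OF disjI2, OF conjI])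
  then show "p \<in> {..k} \<times> {j * n..<r * n}" using i(3) by blast
qed

text \<open>Fekete: let \<open>\<rho>\<close> be the infimum of \<open>H N / real N\<close>. A
  length within \<open>\<beta>\<close> of the infimum loses at most \<open>\<beta>\<close> per unit
  of time against every longer multiple, and by subadditivity its multiples are as good, so
  \<open>p dvd N\<close> can be arranged.\<close>

lemma exists_almost_optimal_length:
  assumes "0 < \<beta>" "0 < p"
  shows "\<exists>N. 0 < N \<and> p dvd N \<and>
    (\<forall>r. real r * h ({..k} \<times> {0..<N}) - h ({..k} \<times> {0..<r * N}) \<le> real r * real N * \<beta>)"
proof -
  define H where "H N = h ({..k} \<times> {0..<N})" for N
  define \<rho> where "\<rho> = (INF N\<in>{0<..}. H N / real N)"
  have H0: "0 \<le> H N" for N unfolding H_def by (intro h_nonneg) auto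
  have bdd: "bdd_below ((\<lambda>N. H N / real N) ` {0<..})"
    using H0 by (intro bdd_belowI[of _ 0]) auto
  have lower: "real N * \<rho> \<le> H N" if "0 < N" for N
  proof -
    have "\<rho> \<le> H N / real N" unfolding \<rho>_def using that bdd by (intro cINF_lower) auto
    then show ?thesis using that by (simp add: field_simps)
  qed
  obtain N where N: "0 < N" "H N / real N < \<rho> + \<beta>"
    using cINF_less_iff[OF _ bdd, of "\<rho> + \<beta>"] assms unfolding \<rho>_def by auto
  have sub: "H (a + b) \<le> H a + H b" for a b
  proof -
    have "h ({..k} \<times> {0..<a} \<union> {..k} \<times> {a..<a + b}) + h ({..k} \<times> {0..<a} \<inter> {..k} \<times> {a..<a + b}) \<le> H a + h ({..k} \<times> {a..<a + b})"
      unfolding H_def by (intro h_submodular) auto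
    moreover have "{..k} \<times> {0..<a} \<union> {..k} \<times> {a..<a + b} = {..k} \<times> {0..<a + b}" by auto
    moreover have "h ({..k} \<times> {a..<a + b}) = H b"
      unfolding H_def using h_tshift[of "{..k} \<times> {0..<b}" a] by (simp add: tshift_rect add.commute)
    moreover have "0 \<le> h ({..k} \<times> {0..<a} \<inter> {..k} \<times> {a..<a + b})" by (intro h_nonneg) auto
    ultimately show ?thesis by (simp add: H_def)
  qed
  \<comment> \<open>The induction starts from one block, since \<open>H 0\<close> is only known to
    be nonnegative.\<close>
  have mult: "H (Suc q * N) \<le> real (Suc q) * H N" for q
  proof (induction q)
    case (Suc q)
    then show ?case using sub[of N "Suc q * N"] by (simp add: algebra_simps)
  qed simp
  obtain q where q: "p = Suc q" using assms(2) gr0_implies_Suc by blast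
  have "H N \<le> real N * (\<rho> + \<beta>)" using N by (simp add: field_simps)
  then have "real p * H N \<le> real p * (real N * (\<rho> + \<beta>))" by (intro mult_left_mono) auto
  moreover have "H (p * N) \<le> real p * H N" using mult[of q] unfolding q .
  ultimately have pN: "H (p * N) \<le> real (p * N) * (\<rho> + \<beta>)"
    by (simp only: of_nat_mult mult.assoc)
  show ?thesis
  proof (intro exI[of _ "p * N"] conjI allI)
    fix r
    show "real r * h ({..k} \<times> {0..<p * N}) - h ({..k} \<times> {0..<r * (p * N)}) \<le> real r * real (p * N) * \<beta>"
    proof (cases "r = 0")
      case True
      then show ?thesis using H0[of 0] by (simp add: H_def)
    next
      case False
      have "real r * H (p * N) \<le> real r * (real (p * N) * (\<rho> + \<beta>))"
        using pN by (intro mult_left_mono) auto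
      moreover have "real (r * (p * N)) * \<rho> \<le> H (r * (p * N))"
        using False N assms by (intro lower) auto
      ultimately show ?thesis unfolding H_def by (simp add: algebra_simps)
    qed
  qed (use N assms in auto)
qed

text \<open>Dependent choice: the scale for level \<open>Suc k\<close> is an almost optimal length
  for the joint observation of the levels up to \<open>Suc k\<close>, taken among the multiples of
  the previous scale.\<close>

lemma exists_scales:
  fixes \<beta> :: "nat \<Rightarrow> real"
  assumes "\<And>k. 0 < \<beta> k"
  shows "\<exists>n. strict_mono n \<and> N0 < n 0 \<and> (\<forall>k. n k dvd n (Suc k)) \<and>
    (\<forall>k r. real r * h ({..k} \<times> {0..<n k}) - h ({..k} \<times> {0..<r * n k}) \<le> real r * real (n k) * \<beta> k)"
proof -
  define good where "good k N \<longleftrightarrow> N0 < N \<and> (\<forall>r. real r * h ({..k} \<times> {0..<N}) - h ({..k} \<times> {0..<r * N}) \<le> real r * real N * \<beta> k)" for k N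
  have "\<exists>n. good 0 n"
    using exists_almost_optimal_length[of "\<beta> 0" "Suc N0" 0] assms dvd_imp_le
    unfolding good_def by (metis Suc_le_lessD zero_less_Suc)
  moreover have "\<exists>y. good (Suc k) y \<and> (x dvd y \<and> x < y)" if x: "good k x" for x k
  proof -
    have x0: "0 < x" using x by (simp add: good_def)
    \<comment> \<open>Divisibility by \<open>2 * x\<close> instead of \<open>x\<close> forces strict
      growth.\<close>
    obtain N where N: "0 < N" "2 * x dvd N" "\<forall>r. real r * h ({..Suc k} \<times> {0..<N}) - h ({..Suc k} \<times> {0..<r * N}) \<le> real r * real N * \<beta> (Suc k)"
      using exists_almost_optimal_length[of "\<beta> (Suc k)" "2 * x" "Suc k"] assms x0 by auto
    have "2 * x \<le> N" using N dvd_imp_le by blast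
    then show ?thesis using N x x0 unfolding good_def
      by (intro exI[of _ N]) (auto dest: dvd_mult_right)
  qed
  ultimately obtain n where n: "\<And>k. good k (n k)" "\<And>k. n k dvd n (Suc k) \<and> n k < n (Suc k)"
    using dependent_nat_choice[of good "\<lambda>_ x y. x dvd y \<and> x < y"] by metis
  then show ?thesis unfolding good_def by (intro exI[of _ n]) (auto simp: strict_mono_Suc_iff)
qed

text \<open>Downward induction on \<open>k\<close>. Since \<open>n (Suc k) = r * n k\<close>,
  sliding the block of scale \<open>k\<close> through the block of scale \<open>Suc k\<close> costs
  \<open>r * n k * \<beta> k\<close>, plus the information between the larger block and its own
  future. Division by \<open>r\<close> adds \<open>\<beta> k\<close> to the sum of the errors. The
  end \<open>E\<close> stays arbitrary because each step enlarges it.\<close>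

lemma mi_past_future:
  assumes n: "strict_mono n" "0 < n 0" and dvd: "\<And>k. n k dvd n (Suc k)"
    and opt: "\<And>k r. real r * h ({..k} \<times> {0..<n k}) - h ({..k} \<times> {0..<r * n k}) \<le> real r * real (n k) * \<beta> k"
    and "k \<le> K"
  shows "mi ({..k} \<times> {0..<n k}) (tail_window n K k E) \<le> real (n k) * (\<Sum>l=k..K. \<beta> l)"
  using \<open>k \<le> K\<close>
proof (induction k arbitrary: E rule: inc_induct)
  case base
  define A where "A = {..K} \<times> {0..<n K}"
  define Y where "Y = tail_window n K K E"
  define c where "c = h ({..K} \<times> {0..<E})"
  have n0: "0 < n K" using n by (metis bot_nat_0.extremum order_less_le_trans strict_mono_less_eq)
  \<comment> \<open>At the top scale all levels up to \<open>K\<close> are observed, and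
    \<open>C\<close> has entropy \<open>c\<close> for every \<open>r\<close> by shift invariance. A
    bound by \<open>c\<close> for all \<open>r\<close> then forces the factor of
    \<open>real r\<close> to be nonpositive.\<close>
  have bnd: "real r * (mi A Y - real (n K) * \<beta> K) \<le> c" for r
  proof -
    define C where "C = {..K} \<times> {r * n K..<E + r * n K}"
    have bl: "(\<Union>i\<in>{j..<r}. tshift (i * n K) A) = {..K} \<times> {j * n K..<r * n K}" for j
      unfolding A_def using union_blocks[OF n0] .
    have "real r * mi A Y \<le> real r * h A - h (\<Union>i\<in>{0..<r}. tshift (i * n K) A)
      + mi (\<Union>i\<in>{0..<r}. tshift (i * n K) A) C"
    proof (rule block_sliding)
      fix j assume j: "j < r"
      have "tshift (j * n K) Y \<subseteq> {..K} \<times> {Suc j * n K..<r * n K} \<union> C"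
      proof (rule subrelI)
        fix i t assume "(i, t) \<in> tshift (j * n K) Y"
        then have t: "i \<le> K" "j * n K \<le> t" "n K \<le> t - j * n K" "t - j * n K < E"
          by (auto simp: mem_tshift Y_def tail_window_def)
        have "j * n K \<le> r * n K" using j by simp
        then have "t < E + r * n K" using t(4) by linarith
        then show "(i, t) \<in> {..K} \<times> {Suc j * n K..<r * n K} \<union> C"
          using t unfolding C_def by auto
      qed
      then show "tshift (j * n K) Y \<subseteq> (\<Union>i\<in>{Suc j..<r}. tshift (i * n K) A) \<union> C"
        unfolding bl .
    qed (auto simp: A_def Y_def C_def)
    moreover have "real r * h A - h (\<Union>i\<in>{0..<r}. tshift (i * n K) A) \<le> real r * real (n K) * \<beta> K"
      unfolding bl using opt[of r K] by (simp add: A_def)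
    moreover have "mi (\<Union>i\<in>{0..<r}. tshift (i * n K) A) C \<le> h C"
      unfolding bl by (intro mi_le) (auto simp: C_def)
    moreover have "h C = c"
      using h_tshift[of "{..K} \<times> {0..<E}" "r * n K"] by (simp add: tshift_rect C_def c_def)
    ultimately show ?thesis by (simp add: algebra_simps)
  qed
  have "mi A Y - real (n K) * \<beta> K \<le> 0"
  proof (rule ccontr)
    assume "\<not> ?thesis"
    then have pos: "0 < mi A Y - real (n K) * \<beta> K" by simp
    obtain r :: nat where "c / (mi A Y - real (n K) * \<beta> K) < real r" using reals_Archimedean2 by blast
    then show False using bnd[of r] pos by (simp add: field_simps)
  qed
  then show ?case by (simp add: A_def Y_def)
next
  case (step k)
  define A where "A = {..k} \<times> {0..<n k}"
  have n0: "0 < n k" using n by (metis bot_nat_0.extremum order_less_le_trans strict_mono_less_eq)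
  obtain r where r: "n (Suc k) = r * n k" using dvd[of k] by (metis dvdE mult.commute)
  \<comment> \<open>A shift moves times by less than \<open>n (Suc k)\<close>. Times of the first
    part of \<open>Y\<close> stay below \<open>2 * n (Suc k)\<close> and those of the second below
    \<open>E + n (Suc k)\<close>, so this end serves both.\<close>
  define C where "C = tail_window n K (Suc k) (E + 2 * n (Suc k))"
  define Y where "Y = {..k} \<times> {n k..<r * n k} \<union> tail_window n K (Suc k) E"
  have r0: "0 < r"
  proof (rule ccontr)
    assume "\<not> 0 < r"
    then have "n (Suc k) = 0" using r by simp
    then show False using strict_monoD[OF n(1), of k "Suc k"] by simp
  qed
  have bl: "(\<Union>i\<in>{j..<r}. tshift (i * n k) A) = {..k} \<times> {j * n k..<r * n k}" for j
    unfolding A_def using union_blocks[OF n0] .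
  \<comment> \<open>Before time \<open>n (Suc k)\<close> only the levels up to \<open>k\<close> are
    switched on, so this part of the tail consists of observations made by the sliding block
    itself.\<close>
  have late: "i \<le> K \<Longrightarrow> n i \<le> t \<Longrightarrow> t < n (Suc k) \<Longrightarrow> i \<le> k" for i t
    using strict_mono_less[OF n(1), of i "Suc k"] by linarith
  have "mi A (tail_window n K k E) \<le> mi A Y"
  proof (rule mi_mono)
    show "tail_window n K k E \<subseteq> Y"
    proof (rule subrelI)
      fix i t assume "(i, t) \<in> tail_window n K k E"
      then show "(i, t) \<in> Y"
        using late[of i t] unfolding tail_window_def Y_def r[symmetric] by (cases "t < n (Suc k)") auto
    qed
  qed (auto simp: A_def Y_def)
  moreover have "real r * mi A Y \<le> real r * h A - h (\<Union>i\<in>{0..<r}. tshift (i * n k) A)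
      + mi (\<Union>i\<in>{0..<r}. tshift (i * n k) A) C"
  proof (rule block_sliding)
    fix j assume j: "j < r"
    have jr: "j * n k < r * n k" using j n0 by simp
    have "tshift (j * n k) Y \<subseteq> {..k} \<times> {Suc j * n k..<r * n k} \<union> C"
    proof (rule subrelI)
      fix i t assume "(i, t) \<in> tshift (j * n k) Y"
      then have t: "j * n k \<le> t" "(i, t - j * n k) \<in> Y" by (auto simp: mem_tshift)
      from t(2) consider "i \<le> k" "n k \<le> t - j * n k" "t - j * n k < r * n k"
        | "i \<le> K" "n i \<le> t - j * n k" "n (Suc k) \<le> t - j * n k" "t - j * n k < E"
        by (auto simp: Y_def tail_window_def)
      then show "(i, t) \<in> {..k} \<times> {Suc j * n k..<r * n k} \<union> C"
      proof cases
        case 1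
        have "n i \<le> n (Suc k)" "i \<le> K" using 1 step.hyps strict_mono_less_eq[OF n(1), of i "Suc k"] by auto
        moreover have "t < 2 * (r * n k)" using 1(3) t(1) jr by linarith
        ultimately show ?thesis using 1 t(1) unfolding C_def tail_window_def r by auto
      next
        case 2
        moreover have "t < E + 2 * (r * n k)" using 2(4) t(1) jr by linarith
        ultimately show ?thesis using t(1) unfolding C_def tail_window_def r by auto
      qed
    qed
    then show "tshift (j * n k) Y \<subseteq> (\<Union>i\<in>{Suc j..<r}. tshift (i * n k) A) \<union> C"
      unfolding bl .
  qed (auto simp: A_def Y_def C_def)
  moreover have "real r * h A - h (\<Union>i\<in>{0..<r}. tshift (i * n k) A) \<le> real r * real (n k) * \<beta> k"
    unfolding bl using opt[of r k] by (simp add: A_def)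
  moreover have "mi (\<Union>i\<in>{0..<r}. tshift (i * n k) A) C \<le> real (n (Suc k)) * (\<Sum>l=Suc k..K. \<beta> l)"
  proof -
    have "mi (\<Union>i\<in>{0..<r}. tshift (i * n k) A) C \<le> mi ({..Suc k} \<times> {0..<n (Suc k)}) C"
      unfolding bl by (rule mi_mono) (auto simp: C_def r)
    also have "\<dots> \<le> real (n (Suc k)) * (\<Sum>l=Suc k..K. \<beta> l)" unfolding C_def by (rule step.IH)
    finally show ?thesis .
  qed
  ultimately have "real r * mi A (tail_window n K k E) \<le> real r * (real (n k) * \<beta> k + real (n k) * (\<Sum>l=Suc k..K. \<beta> l))"
    using mult_left_mono[of "mi A (tail_window n K k E)" "mi A Y" "real r"] r by (simp add: algebra_simps)
  then have "mi A (tail_window n K k E) \<le> real (n k) * \<beta> k + real (n k) * (\<Sum>l=Suc k..K. \<beta> l)"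
    using r0 by simp
  also have "\<dots> = real (n k) * (\<Sum>l=k..K. \<beta> l)"
    using step.hyps by (simp add: sum.atLeast_Suc_atMost algebra_simps)
  finally show ?case by (simp add: A_def)
qed

end

text \<open>The value 0 off \<open>S\<close> gives the names for all windows one type, and makes
  equality of names mean agreement on \<open>S\<close>.\<close>

definition itinerary :: "('a \<Rightarrow> 'a) \<Rightarrow> (nat \<Rightarrow> 'a \<Rightarrow> nat) \<Rightarrow> (nat \<times> nat) set \<Rightarrow> 'a \<Rightarrow> nat \<times> nat \<Rightarrow> nat" where
  "itinerary T q S x = (\<lambda>(i, t). if (i, t) \<in> S then q i ((T ^^ t) x) else 0)"

lemma itinerary_eq_iff:
  "itinerary T q S x = itinerary T q S y \<longleftrightarrow> (\<forall>(i, t)\<in>S. q i ((T ^^ t) x) = q i ((T ^^ t) y))"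
  by (auto simp: itinerary_def fun_eq_iff)

lemma finite_range_itinerary:
  assumes "\<And>i. finite (range (q i))" and "finite S"
  shows "finite (range (itinerary T q S))"
proof -
  have "range (itinerary T q S) \<subseteq>
      (\<lambda>f p. if p \<in> S then f p else 0) ` PiE S (\<lambda>p. range (q (fst p)))"
  proof (rule image_subsetI)
    fix x
    show "itinerary T q S x \<in> (\<lambda>f p. if p \<in> S then f p else 0) ` PiE S (\<lambda>p. range (q (fst p)))"
      by (rule image_eqI[of _ _ "restrict (itinerary T q S x) S"])
        (auto simp: itinerary_def fun_eq_iff)
  qed
  then show ?thesis by (rule finite_subset) (use assms in \<open>auto intro!: finite_PiE\<close>)
qed

lemma card_range_itinerary:
  assumes "finite (range (q i))"
  shows "card (range (itinerary T q ({i} \<times> {0..<n}))) \<le> card (range (q i)) ^ n"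
proof -
  let ?S = "{i} \<times> {0..<n}"
  let ?P = "PiE ?S (\<lambda>p. range (q i))"
  have fin: "finite ?P" using assms by (auto intro!: finite_PiE)
  have "range (itinerary T q ?S) \<subseteq> (\<lambda>f p. if p \<in> ?S then f p else 0) ` ?P"
  proof (rule image_subsetI)
    fix x
    show "itinerary T q ?S x \<in> (\<lambda>f p. if p \<in> ?S then f p else 0) ` ?P"
      by (rule image_eqI[of _ _ "restrict (itinerary T q ?S x) ?S"])
        (auto simp: itinerary_def fun_eq_iff)
  qed
  then have "card (range (itinerary T q ?S)) \<le> card ?P"
    using fin card_mono card_image_le by (meson finite_imageI le_trans)
  then show ?thesis by (simp add: card_PiE card_cartesian_product)
qed

section \<open>Entropies of itineraries under an invariant probability\<close>

locale invariant_fa_prob = fa_prob m for m :: "'a set \<Rightarrow> real" +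
  fixes T :: "'a \<Rightarrow> 'a" and q :: "nat \<Rightarrow> 'a \<Rightarrow> nat"
  assumes invariant: "m (T -` A) = m A"
    and finite_q: "finite (range (q i))"
begin

lemma funpow_invariant: "m ((T ^^ s) -` A) = m A"
proof (induction s arbitrary: A)
  case (Suc s)
  have "(T ^^ Suc s) -` A = (T ^^ s) -` (T -` A)" by auto
  then show ?case using Suc[of "T -` A"] invariant[of A] by metis
qed (simp add: vimage_def)

lemma finite_itinerary: "finite S \<Longrightarrow> finite (range (itinerary T q S))"
  by (rule finite_range_itinerary[OF finite_q])

lemma ent_itinerary_pair:
  assumes "finite S" "finite U"
  shows "ent m (\<lambda>x. (itinerary T q S x, itinerary T q U x)) = ent m (itinerary T q (S \<union> U))"
proof (rule ent_cong)
  have "range (\<lambda>x. (itinerary T q S x, itinerary T q U x)) \<subseteq> range (itinerary T q S) \<times> range (itinerary T q U)"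
    by auto
  then show "finite (range (\<lambda>x. (itinerary T q S x, itinerary T q U x)))"
    by (rule finite_subset) (use assms in \<open>auto simp: finite_itinerary\<close>)
  show "finite (range (itinerary T q (S \<union> U)))" using assms by (simp add: finite_itinerary)
qed (auto simp: itinerary_eq_iff)

lemma ent_itinerary_shift:
  assumes "finite S"
  shows "ent m (itinerary T q (tshift s S)) = ent m (itinerary T q S)"
proof -
  have "ent m (itinerary T q (tshift s S)) = ent m (itinerary T q S \<circ> (T ^^ s))"
  proof (rule ent_cong)
    have "range (itinerary T q S \<circ> (T ^^ s)) \<subseteq> range (itinerary T q S)" by auto
    then show "finite (range (itinerary T q S \<circ> (T ^^ s)))"
      using assms by (meson finite_itinerary finite_subset)
    show "finite (range (itinerary T q (tshift s S)))" using assms by (simp add: finite_itinerary)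
  qed (auto simp: itinerary_eq_iff tshift_def funpow_add)
  also have "\<dots> = ent m (itinerary T q S)"
  proof -
    let ?f = "itinerary T q S"
    have eq: "m ((?f \<circ> (T ^^ s)) -` {v}) = m (?f -` {v})" for v
      using funpow_invariant[of s "?f -` {v}"] by (simp add: vimage_comp)
    \<comment> \<open>Composition with \<open>T ^^ s\<close> may miss some names; by invariance
      these have mass 0.\<close>
    have "(\<Sum>v\<in>range (?f \<circ> (T ^^ s)). m (?f -` {v}) * ln (m (?f -` {v})))
        = (\<Sum>v\<in>range ?f. m (?f -` {v}) * ln (m (?f -` {v})))"
    proof (rule sum.mono_neutral_left)
      show "\<forall>v\<in>range ?f - range (?f \<circ> (T ^^ s)). m (?f -` {v}) * ln (m (?f -` {v})) = 0"
        using eq law_pos_imp_range[of "?f \<circ> (T ^^ s)"] nonneg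
        by (metis DiffD2 less_eq_real_def mult_zero_left)
    qed (use assms in \<open>auto simp: finite_itinerary\<close>)
    then show ?thesis by (simp add: ent_def eq)
  qed
  finally show ?thesis .
qed

text \<open>Submodularity is \<open>ent_submodular\<close> for the names on \<open>S - U\<close> and
  \<open>U - S\<close>, conditioned on those on \<open>S \<inter> U\<close>.\<close>

sublocale names: shift_polymatroid "\<lambda>S. ent m (itinerary T q S)"
proof
  fix S U :: "(nat \<times> nat) set"
  assume S: "finite S" and U: "finite U"
  have "ent m (\<lambda>x. (itinerary T q (S - U) x, itinerary T q (U - S) x, itinerary T q (S \<inter> U) x)) + ent m (itinerary T q (S \<inter> U))
       \<le> ent m (\<lambda>x. (itinerary T q (S - U) x, itinerary T q (S \<inter> U) x)) + ent m (\<lambda>x. (itinerary T q (U - S) x, itinerary T q (S \<inter> U) x))"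
    using S U by (intro ent_submodular finite_itinerary) auto
  moreover have "ent m (\<lambda>x. (itinerary T q (S - U) x, itinerary T q (S \<inter> U) x)) = ent m (itinerary T q S)"
    using S U by (subst ent_itinerary_pair) (auto simp: Un_Diff_Int)
  moreover have "ent m (\<lambda>x. (itinerary T q (U - S) x, itinerary T q (S \<inter> U) x)) = ent m (itinerary T q U)"
    using S U by (subst ent_itinerary_pair) (auto simp: Un_Diff_Int Int_commute[of S U])
  moreover have "ent m (itinerary T q (S \<union> U))
     \<le> ent m (\<lambda>x. (itinerary T q (S - U) x, itinerary T q (U - S) x, itinerary T q (S \<inter> U) x))"
  proof (rule ent_mono)
    have "range (\<lambda>x. (itinerary T q (S - U) x, itinerary T q (U - S) x, itinerary T q (S \<inter> U) x))
        \<subseteq> range (itinerary T q (S - U)) \<times> range (itinerary T q (U - S)) \<times> range (itinerary T q (S \<inter> U))"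
      by auto
    then show "finite (range (\<lambda>x. (itinerary T q (S - U) x, itinerary T q (U - S) x, itinerary T q (S \<inter> U) x)))"
      by (rule finite_subset) (use S U in \<open>auto simp: finite_itinerary\<close>)
  next
    fix x y
    assume "(itinerary T q (S - U) x, itinerary T q (U - S) x, itinerary T q (S \<inter> U) x)
        = (itinerary T q (S - U) y, itinerary T q (U - S) y, itinerary T q (S \<inter> U) y)"
    then show "itinerary T q (S \<union> U) x = itinerary T q (S \<union> U) y"
      unfolding prod.inject itinerary_eq_iff by blast
  qed
  ultimately show "ent m (itinerary T q (S \<union> U)) + ent m (itinerary T q (S \<inter> U))
      \<le> ent m (itinerary T q S) + ent m (itinerary T q U)"
    by simp
next
  fix S U :: "(nat \<times> nat) set"
  assume U: "finite U" and SU: "S \<subseteq> U"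
  show "ent m (itinerary T q S) \<le> ent m (itinerary T q U)"
  proof (rule ent_mono[OF finite_itinerary[OF U]])
    fix x y assume "itinerary T q U x = itinerary T q U y"
    then show "itinerary T q S x = itinerary T q S y"
      unfolding itinerary_eq_iff using SU by blast
  qed
qed (simp_all add: ent_nonneg ent_itinerary_shift)

end

section \<open>Fibers of the tail observations\<close>

text \<open>
  A finitely additive substitute for the reverse Fatou lemma: compactness replaces countable
  additivity.
\<close>

lemma exists_mem_infinitely_many:
  fixes C :: "nat \<Rightarrow> nat \<Rightarrow> 'a::metric_space set"
  assumes "fa_prob m" and X: "compact X" and c: "0 < c"
    and closed: "\<And>k K. closed (C k K)" and sub: "\<And>k K. C k K \<subseteq> X"
    and anti: "\<And>k K K'. K \<le> K' \<Longrightarrow> C k K' \<subseteq> C k K"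
    and mass: "\<And>k K. c \<le> m (C k K)"
  shows "\<exists>x. \<forall>j. \<exists>k\<ge>j. \<forall>K. x \<in> C k K"
proof -
  interpret fa_prob m by fact
  define D where "D j M K = (\<Union>k\<in>{j..M}. C k K)" for j M K :: nat
  define L where "L j M = (INF K. m (D j M K))" for j M
  have D_anti: "D j M K' \<subseteq> D j M K" if "K \<le> K'" for j M K K'
    unfolding D_def using anti[OF that] by blast
  have D_mono: "D j M K \<subseteq> D j M' K" if "M \<le> M'" for j M M' K
    unfolding D_def using that by (intro UN_mono) auto
  have bdd: "bdd_below (range (\<lambda>K. m (D j M K)))" for j M
    by (rule bdd_belowI[of _ 0]) (auto simp: nonneg)
  have L_le: "L j M \<le> m (D j M K)" for j M K
    unfolding L_def using bdd by (rule cINF_lower) simp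
  \<comment> \<open>\<open>L j M\<close> is the limit of the masses in \<open>K\<close>. If
    \<open>L j N\<close> is within \<open>e / 2\<close> of the supremum over \<open>M\<close>,
    indices beyond \<open>N\<close> add at most \<open>e\<close> of mass at all sufficiently large
    depths \<open>K\<close>.\<close>
  have stable: "\<exists>N\<ge>j. \<forall>M. \<exists>K0. \<forall>K\<ge>K0. m (D j M K) \<le> m (D j N K) + e" if e: "0 < e" for j e
  proof -
    have bddL: "bdd_above (range (L j))"
    proof (rule bdd_aboveI[of _ 1])
      show "y \<le> 1" if "y \<in> range (L j)" for y
        using that L_le[of j _ 0] le_one order_trans by blast
    qed
    obtain N0 where N0: "(SUP M. L j M) - e / 2 < L j N0"
      using less_cSUP_iff[OF _ bddL, of "(SUP M. L j M) - e / 2"] e by auto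
    define N where "N = max j N0"
    show ?thesis
    proof (rule exI[of _ N], intro conjI allI)
      fix M
      have "L j M < L j M + e / 2" using e by simp
      then obtain K0 where K0: "m (D j M K0) < L j M + e / 2"
        using cINF_less_iff[OF _ bdd, of j M "L j M + e / 2"] unfolding L_def by auto
      have "m (D j M K) \<le> m (D j N K) + e" if "K0 \<le> K" for K
      proof -
        have "m (D j M K) \<le> m (D j M K0)" by (intro mono D_anti that)
        also have "\<dots> \<le> (SUP M. L j M) + e / 2"
          using K0 cSUP_upper[OF UNIV_I bddL, of M] by linarith
        also have "\<dots> \<le> L j N0 + e" using N0 by (simp add: field_simps)
        also have "\<dots> \<le> m (D j N0 K) + e" using L_le by simp
        also have "\<dots> \<le> m (D j N K) + e" using D_mono[of N0 N] by (simp add: N_def mono)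
        finally show ?thesis .
      qed
      then show "\<exists>K0. \<forall>K\<ge>K0. m (D j M K) \<le> m (D j N K) + e" by blast
    qed (simp add: N_def)
  qed
  \<comment> \<open>The errors \<open>c / 2 ^ (j + 2)\<close> sum to less than \<open>c\<close>, so
    the losses for all \<open>j\<close> together cannot exhaust a set of mass
    \<open>c\<close>.\<close>
  have "\<forall>j. \<exists>N\<ge>j. \<forall>M. \<exists>K0. \<forall>K\<ge>K0. m (D j M K) \<le> m (D j N K) + c / 2 ^ (j + 2)"
    using stable c by simp
  then obtain N where N: "\<And>j. j \<le> N j"
    and "\<And>j M. \<exists>K0. \<forall>K\<ge>K0. m (D j M K) \<le> m (D j (N j) K) + c / 2 ^ (j + 2)"
    by metis
  then obtain K0 where K0: "\<And>j M K. K0 j M \<le> K \<Longrightarrow> m (D j M K) \<le> m (D j (N j) K) + c / 2 ^ (j + 2)"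
    by metis
  \<comment> \<open>\<open>J\<close> bounds both the number of constraints and the depth, which
    makes \<open>F\<close> a decreasing sequence of closed sets.\<close>
  define F where "F J = (\<Inter>j\<in>{..J}. D j (N j) J)" for J
  have ne: "F J \<noteq> {}" for J
  proof -
    define M where "M = Max (N ` {..J})"
    have M: "N j \<le> M" if "j \<le> J" for j unfolding M_def using that by (intro Max_ge) auto
    define K where "K = Max (insert J ((\<lambda>j. K0 j M) ` {..J}))"
    have "y \<le> K" if "y \<in> insert J ((\<lambda>j. K0 j M) ` {..J})" for y
      unfolding K_def by (rule Max_ge[OF _ that]) simp
    then have K: "J \<le> K" "\<And>j. j \<le> J \<Longrightarrow> K0 j M \<le> K" by auto
    define I where "I = (\<Inter>j\<in>{..J}. D j (N j) K)"
    have "m (D j M K - D j (N j) K) \<le> c / 2 ^ (j + 2)" if "j \<le> J" for j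
      using diff[OF D_mono[OF M[OF that]]] K0[OF K(2)[OF that]] by simp
    then have "(\<Sum>j\<in>{..J}. m (D j M K - D j (N j) K)) \<le> (\<Sum>j\<in>{..J}. c / 2 ^ (j + 2))"
      by (intro sum_mono) auto
    also have "\<dots> = c / 2 - c / 2 ^ (J + 2)"
      by (induction J) (auto simp: field_simps)
    also have "\<dots> < c"
    proof -
      have "0 < c / 2 ^ (J + 2)" using c by simp
      then show ?thesis using c by linarith
    qed
    finally have small: "(\<Sum>j\<in>{..J}. m (D j M K - D j (N j) K)) < c" .
    \<comment> \<open>\<open>J \<le> N J \<le> M\<close> places \<open>C J K\<close> inside
      \<open>D j M K\<close> for every \<open>j \<le> J\<close>; cutting down to
      \<open>D j (N j) K\<close> loses only the small differences.\<close>
    have "C J K \<subseteq> I \<union> (\<Union>j\<in>{..J}. D j M K - D j (N j) K)"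
    proof
      fix x assume x: "x \<in> C J K"
      have "x \<in> D j M K" if "j \<le> J" for j
        using x that M[of J] N[of J] by (auto simp: D_def)
      then show "x \<in> I \<union> (\<Union>j\<in>{..J}. D j M K - D j (N j) K)" unfolding I_def by blast
    qed
    then have "c \<le> m (I \<union> (\<Union>j\<in>{..J}. D j M K - D j (N j) K))"
      using mass[of J K] mono order_trans by blast
    also have "\<dots> \<le> m I + (\<Sum>j\<in>{..J}. m (D j M K - D j (N j) K))"
      by (rule order_trans[OF subadditive add_left_mono[OF finite_subadditive]]) simp
    finally have "0 < m I" using small by simp
    then have "I \<noteq> {}" using empty by auto
    moreover have "I \<subseteq> F J" unfolding I_def F_def using D_anti[OF K(1)] by blast
    ultimately show ?thesis by blast
  qed
  have F_closed: "closed (F J)" for J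
    unfolding F_def D_def by (intro closed_INT closed_UN ballI closed) auto
  have F_sub: "F J' \<subseteq> F J" if "J \<le> J'" for J J'
  proof -
    have "F J' \<subseteq> (\<Inter>j\<in>{..J}. D j (N j) J')" unfolding F_def using that by auto
    also have "\<dots> \<subseteq> F J" unfolding F_def using D_anti[OF that] by blast
    finally show ?thesis .
  qed
  have fip: "X \<inter> \<Inter>(F ` I) \<noteq> {}" if I: "finite I" for I
  proof -
    have "F J \<subseteq> X" for J unfolding F_def D_def using sub by blast
    moreover have "F (Max (insert 0 I)) \<subseteq> \<Inter>(F ` I)"
      by (rule INT_greatest, rule F_sub, rule Max_ge) (use I in auto)
    ultimately show ?thesis using ne[of "Max (insert 0 I)"] by blast
  qed
  have "X \<inter> \<Inter>(range F) \<noteq> {}"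
    by (rule compact_imp_fip_image[OF X F_closed fip])
  then obtain x where x: "\<And>J. x \<in> F J" by blast
  \<comment> \<open>Were \<open>x\<close> to leave each of the finitely many \<open>C k\<close> with
    \<open>k\<close> in \<open>{j..N j}\<close> at some depth, a common larger depth
    \<open>J\<close> would contradict \<open>x \<in> D j (N j) J\<close>.\<close>
  have "\<exists>k\<ge>j. \<forall>K. x \<in> C k K" for j
  proof (rule ccontr)
    assume "\<not> ?thesis"
    then have "\<forall>k\<in>{j..N j}. \<exists>K. x \<notin> C k K" by auto
    then obtain \<kappa> where \<kappa>: "\<And>k. k \<in> {j..N j} \<Longrightarrow> x \<notin> C k (\<kappa> k)" by metis
    define J where "J = Max (insert j (\<kappa> ` {j..N j}))"
    have "y \<le> J" if "y \<in> insert j (\<kappa> ` {j..N j})" for y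
      unfolding J_def by (rule Max_ge[OF _ that]) simp
    then have J: "j \<le> J" "\<And>k. k \<in> {j..N j} \<Longrightarrow> \<kappa> k \<le> J" by auto
    have "x \<in> D j (N j) J" using x[of J] J(1) by (auto simp: F_def)
    then obtain k where k: "k \<in> {j..N j}" "x \<in> C k J" by (auto simp: D_def)
    then show False using \<kappa>[OF k(1)] anti[OF J(2)[OF k(1)]] by blast
  qed
  then show ?thesis by blast
qed

text \<open>Distances replace code values: the conditions are closed and pass to limits, while
  points of \<open>X\<close> with equal names on \<open>Y\<close> still share a fiber, because
  \<open>\<delta> i\<close> bounds the mesh of \<open>q i\<close>.\<close>

definition fiber :: "'a::metric_space set \<Rightarrow> ('a \<Rightarrow> 'a) \<Rightarrow> (nat \<Rightarrow> real) \<Rightarrow> (nat \<times> nat) set \<Rightarrow> 'a \<Rightarrow> 'a set" where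
  "fiber X T \<delta> Y x = {y \<in> X. \<forall>(i, t)\<in>Y. dist ((T ^^ t) x) ((T ^^ t) y) \<le> \<delta> i}"

definition coverable :: "'a::metric_space set \<Rightarrow> ('a \<Rightarrow> 'a) \<Rightarrow> nat \<Rightarrow> real \<Rightarrow> real \<Rightarrow> 'a set \<Rightarrow> bool" where
  "coverable X T n \<epsilon> B Z \<longleftrightarrow> (\<exists>E. finite E \<and> E \<subseteq> X \<and> real (card E) \<le> B \<and>
     (\<forall>y\<in>Z. \<exists>z\<in>E. \<forall>t<n. dist ((T ^^ t) y) ((T ^^ t) z) < \<epsilon>))"

lemma funpow_mem: "T ` X \<subseteq> X \<Longrightarrow> x \<in> X \<Longrightarrow> (T ^^ t) x \<in> X"
  by (induction t) auto

text \<open>Let \<open>f\<close> be the level-zero name on \<open>[0, n)\<close> and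
  \<open>g\<close> the name on \<open>Y\<close>. About \<open>exp (n * \<theta>)\<close> greedily
  chosen fibers contain most names of every other fiber over \<open>G\<close>, up to mass
  \<open>exp (- n * \<theta>)\<close>. As \<open>f\<close> and \<open>g\<close> are almost
  independent, the points of \<open>G\<close> with names outside the chosen ones have small mass.
  The others are described by few centres, which bounds the entropy of a partition of diameter less
  than \<open>\<epsilon>\<close>.\<close>

lemma entropy_bound_of_coverable_fibers:
  fixes X :: "'a::metric_space set"
  assumes "invariant_fa_prob m T q" and TX: "T ` X \<subseteq> X" and mX: "m X = 1"
    and q: "\<And>i x y. x \<in> X \<Longrightarrow> y \<in> X \<Longrightarrow> q i x = q i y \<Longrightarrow> dist x y \<le> \<delta> i"
    and \<epsilon>: "0 < \<epsilon>" "\<delta> 0 \<le> \<epsilon> / 4"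
    and lower: "\<And>Q :: 'a \<Rightarrow> 'a + (nat \<times> nat \<Rightarrow> nat). finite (range Q) \<Longrightarrow>
        (\<And>x y t. x \<in> X \<Longrightarrow> y \<in> X \<Longrightarrow> Q x = Q y \<Longrightarrow> t < n \<Longrightarrow> dist ((T ^^ t) x) ((T ^^ t) y) < \<epsilon>)
        \<Longrightarrow> real n * b \<le> ent m Q"
    and n: "0 < n" and \<theta>: "0 < \<theta>" and Y: "finite Y"
    and mi: "shift_polymatroid.mi (\<lambda>S. ent m (itinerary T q S)) ({0} \<times> {0..<n}) Y \<le> real n * \<beta>"
    and G: "G \<subseteq> X" "\<And>x. x \<in> G \<Longrightarrow> coverable X T n (\<epsilon> / 4) (exp (real n * a)) (fiber X T \<delta> Y x)"
  shows "real n * b \<le> ln 2 + real n * (a + \<theta>) +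
    (m (X - G) + (real n * \<beta> + ln 2) / (real n * \<theta>)) * (real n * (ln (card (range (q 0))) + \<bar>a\<bar> + \<theta>))"
proof -
  interpret invariant_fa_prob m T q by fact
  define f where "f = itinerary T q ({0} \<times> {0..<n})"
  define g where "g = itinerary T q Y"
  define l where "l = real n * \<theta>"
  define D where "D = ln (card (range (q 0)))"
  have l: "0 < l" using n \<theta> by (simp add: l_def)
  have ff: "finite (range f)" unfolding f_def by (rule finite_itinerary) auto
  have fg: "finite (range g)" unfolding g_def by (rule finite_itinerary[OF Y])
  have f_dist: "dist ((T ^^ t) x) ((T ^^ t) y) \<le> \<epsilon> / 4" if "x \<in> X" "y \<in> X" "f x = f y" "t < n" for x y t
  proof -
    have "q 0 ((T ^^ t) x) = q 0 ((T ^^ t) y)"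
      using that unfolding f_def itinerary_eq_iff by auto
    then show ?thesis using q[of "(T ^^ t) x" "(T ^^ t) y" 0] \<epsilon> funpow_mem[OF TX] that by fastforce
  qed
  define V where "V = g ` G"
  have "\<exists>x. x \<in> G \<and> g x = v" if "v \<in> V" for v using that by (auto simp: V_def)
  then obtain p where p: "\<And>v. v \<in> V \<Longrightarrow> p v \<in> G \<and> g (p v) = v" by metis
  then have "\<exists>E. finite E \<and> E \<subseteq> X \<and> real (card E) \<le> exp (real n * a) \<and>
     (\<forall>y\<in>fiber X T \<delta> Y (p v). \<exists>z\<in>E. \<forall>t<n. dist ((T ^^ t) y) ((T ^^ t) z) < \<epsilon> / 4)" if "v \<in> V" for v
    using G(2) that unfolding coverable_def by blast
  then obtain E where E: "\<And>v. v \<in> V \<Longrightarrow> finite (E v) \<and> real (card (E v)) \<le> exp (real n * a) \<and>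
     (\<forall>y\<in>fiber X T \<delta> Y (p v). \<exists>z\<in>E v. \<forall>t<n. dist ((T ^^ t) y) ((T ^^ t) z) < \<epsilon> / 4)"
    by metis
  \<comment> \<open>The level-zero names occurring in \<open>X\<close> together with the tail name
    \<open>v\<close>. Every \<open>x\<close> in \<open>X\<close> satisfies
    \<open>f x \<in> W (g x)\<close>, so a point of \<open>G\<close> with name outside
    \<open>U\<close> lies in the set \<open>S\<close> below.\<close>
  define W where "W v = f ` {y \<in> X. g y = v}" for v
  obtain V' where V': "V' \<subseteq> V" "finite V'" "real (card V') \<le> exp l"
    and small: "\<And>v. v \<in> V \<Longrightarrow> m (f -` W v - (\<Union>u\<in>V'. f -` W u)) \<le> exp (- l)"
    using greedy_cover[of V l "\<lambda>v. f -` W v"] by blast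
  define U where "U = (\<Union>u\<in>V'. W u)"
  have uncovered: "m {x. f x \<notin> U} \<le> m (X - G) + (real n * \<beta> + ln 2) / l"
  proof -
    define S where "S = {x. g x \<in> V \<and> f x \<in> W (g x) - U}"
    have "l * m S \<le> ent m f + ent m g - ent m (\<lambda>x. (f x, g x)) + ln 2"
      unfolding S_def
    proof (rule mutual_information_event[OF ff fg])
      fix v assume v: "v \<in> V"
      have "f -` (W v - U) = f -` W v - (\<Union>u\<in>V'. f -` W u)" by (auto simp: U_def)
      then show "m (f -` (W v - U)) \<le> exp (- l)" using small[OF v] by simp
    qed (use l in simp)
    also have "ent m f + ent m g - ent m (\<lambda>x. (f x, g x)) \<le> real n * \<beta>"
      using mi Y unfolding names.mi_def f_def g_def by (subst ent_itinerary_pair) auto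
    finally have S: "m S \<le> (real n * \<beta> + ln 2) / l" using l by (simp add: field_simps)
    have "{x. f x \<notin> U} \<subseteq> - X \<union> ((X - G) \<union> S)"
      by (auto simp: S_def V_def W_def)
    then have "m {x. f x \<notin> U} \<le> m (- X \<union> ((X - G) \<union> S))" by (rule mono)
    also have "\<dots> \<le> m (- X) + (m (X - G) + m S)"
      using subadditive[of "- X" "(X - G) \<union> S"] subadditive[of "X - G" S] by simp
    finally show ?thesis using S compl[of X] mX by simp
  qed
  define C where "C = (\<Union>v\<in>V'. E v)"
  have finC: "finite C" unfolding C_def using V' E by blast
  have cardC: "real (card C) \<le> exp (real n * (a + \<theta>))"
  proof -
    have "card C \<le> (\<Sum>v\<in>V'. card (E v))" unfolding C_def using V'(2) by (rule card_UN_le)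
    then have "real (card C) \<le> (\<Sum>v\<in>V'. real (card (E v)))" by (simp flip: of_nat_sum)
    also have "\<dots> \<le> (\<Sum>v\<in>V'. exp (real n * a))" using V' E by (intro sum_mono) blast
    also have "\<dots> \<le> exp l * exp (real n * a)" using V' by simp
    finally show ?thesis by (simp add: l_def exp_add[symmetric] algebra_simps)
  qed
  \<comment> \<open>One \<open>\<epsilon> / 4\<close> comes from the mesh of the level-zero code and
    one from the cover of the fiber, so points sharing a centre are less than
    \<open>\<epsilon>\<close> apart.\<close>
  have "\<exists>z\<in>C. \<forall>y\<in>X. f y = w \<longrightarrow> (\<forall>t<n. dist ((T ^^ t) y) ((T ^^ t) z) < \<epsilon> / 2)" if w: "w \<in> U" for w
  proof -
    obtain v y where vy: "v \<in> V'" "y \<in> X" "g y = v" "f y = w" using w by (auto simp: U_def W_def)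
    have v: "v \<in> V" using vy V' by blast
    have "y \<in> fiber X T \<delta> Y (p v)"
    proof -
      have "q i ((T ^^ t) (p v)) = q i ((T ^^ t) y)" if "(i, t) \<in> Y" for i t
        using that p[OF v] vy(3) unfolding g_def itinerary_eq_iff by (metis (mono_tags, lifting) case_prodD itinerary_eq_iff)
      then show ?thesis
        using q funpow_mem[OF TX] p[OF v] G(1) vy(2) unfolding fiber_def by auto
    qed
    then obtain z where z: "z \<in> E v" "\<forall>t<n. dist ((T ^^ t) y) ((T ^^ t) z) < \<epsilon> / 4"
      using E[OF v] by blast
    have "dist ((T ^^ t) y') ((T ^^ t) z) < \<epsilon> / 2" if "y' \<in> X" "f y' = w" "t < n" for y' t
      using f_dist[of y' y t] that vy z(2)[rule_format, of t]
        dist_triangle[of "(T ^^ t) y'" "(T ^^ t) z" "(T ^^ t) y"] by simp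
    then show ?thesis using z(1) vy(1) unfolding C_def by blast
  qed
  then obtain ctr where ctr: "\<And>w. w \<in> U \<Longrightarrow> ctr w \<in> C \<and>
      (\<forall>y\<in>X. f y = w \<longrightarrow> (\<forall>t<n. dist ((T ^^ t) y) ((T ^^ t) (ctr w)) < \<epsilon> / 2))" by metis
  define Q :: "'a \<Rightarrow> 'a + (nat \<times> nat \<Rightarrow> nat)" where
    "Q x = (if f x \<in> U then Inl (ctr (f x)) else Inr (f x))" for x
  \<comment> \<open>There are at most \<open>exp (n * (a + \<theta>))\<close> centres and
    \<open>exp (n * D)\<close> names, so these weights give each kind total mass at most one
    half.\<close>
  define r :: "'a + (nat \<times> nat \<Rightarrow> nat) \<Rightarrow> real" where
    "r = case_sum (\<lambda>_. exp (- (real n * (a + \<theta>))) / 2) (\<lambda>_. exp (- (real n * D)) / 2)"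
  have rangeQ: "range Q \<subseteq> Inl ` C \<union> Inr ` range f" using ctr by (auto simp: Q_def)
  have finQ: "finite (range Q)" using rangeQ finC ff by (meson finite_UnI finite_imageI finite_subset)
  have "real n * b \<le> ent m Q"
  proof (rule lower[OF finQ])
    fix x y t assume xy: "x \<in> X" "y \<in> X" "Q x = Q y" "t < n"
    show "dist ((T ^^ t) x) ((T ^^ t) y) < \<epsilon>"
    proof (cases "f x \<in> U")
      case True
      then have U: "f y \<in> U" "ctr (f x) = ctr (f y)" using xy(3) by (auto simp: Q_def split: if_splits)
      have "dist ((T ^^ t) x) ((T ^^ t) (ctr (f x))) < \<epsilon> / 2" using ctr[OF True] xy by blast
      moreover have "dist ((T ^^ t) y) ((T ^^ t) (ctr (f x))) < \<epsilon> / 2"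
        using ctr[OF U(1)] xy unfolding U(2) by blast
      ultimately show ?thesis
        using dist_triangle2[of "(T ^^ t) x" "(T ^^ t) y" "(T ^^ t) (ctr (f x))"] by simp
    next
      case False
      then have "f x = f y" using xy(3) by (auto simp: Q_def split: if_splits)
      then show ?thesis using f_dist[OF xy(1,2) _ xy(4)] \<epsilon> by simp
    qed
  qed
  also have "ent m Q \<le> - (\<Sum>v\<in>range Q. m (Q -` {v}) * ln (r v))"
  proof (rule ent_le_cross_entropy[OF finQ])
    show "0 < r v" for v by (cases v) (auto simp: r_def)
    have "real (card (range f)) \<le> exp (real n * D)"
    proof -
      have c0: "0 < card (range (q 0))" using finite_q by (simp add: card_gt_0_iff)
      have "real (card (range f)) \<le> real (card (range (q 0)) ^ n)"
        unfolding f_def by (intro of_nat_mono card_range_itinerary finite_q)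
      also have "\<dots> = exp (real n * D)" using c0 by (simp add: D_def exp_of_nat_mult)
      finally show ?thesis .
    qed
    have "sum r (range Q) \<le> sum r (Inl ` C \<union> Inr ` range f)"
      by (rule sum_mono2) (use finC ff rangeQ in \<open>auto simp: r_def\<close>)
    also have "\<dots> = sum r (Inl ` C) + sum r (Inr ` range f)"
      using finC ff by (intro sum.union_disjoint) auto
    also have "\<dots> = real (card C) * (exp (- (real n * (a + \<theta>))) / 2) + real (card (range f)) * (exp (- (real n * D)) / 2)"
      by (simp add: sum.reindex r_def)
    also have "\<dots> \<le> exp (real n * (a + \<theta>)) * (exp (- (real n * (a + \<theta>))) / 2) + exp (real n * D) * (exp (- (real n * D)) / 2)"
      using cardC \<open>real (card (range f)) \<le> _\<close> by (intro add_mono mult_right_mono) auto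
    also have "\<dots> = 1" by (simp add: exp_minus)
    finally show "sum r (range Q) \<le> 1" .
  qed
  also have "\<dots> = (\<Sum>v\<in>range Q. m (Q -` {v}) * - ln (r v))"
    by (simp add: sum_negf)
  also have "\<dots> \<le> (\<Sum>v\<in>range Q. m (Q -` {v}) * (ln 2 + real n * (a + \<theta>))
       + (m (Q -` {v}) * indicator (range Inr) v) * (real n * (D + \<bar>a\<bar> + \<theta>)))"
  proof (rule sum_mono)
    fix v
    have "- ln (r v) \<le> ln 2 + real n * (a + \<theta>) + indicator (range Inr) v * (real n * (D + \<bar>a\<bar> + \<theta>))"
    proof (cases v)
      case (Inl z)
      then show ?thesis by (auto simp: r_def ln_div indicator_def)
    next
      case (Inr w)
      \<comment> \<open>The term \<open>\<bar>a\<bar>\<close> absorbs a negative \<open>a\<close> in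
        the cost already charged to every cell.\<close>
      have "real n * D \<le> real n * ((a + \<theta>) + (D + \<bar>a\<bar> + \<theta>))"
        using \<theta> by (intro mult_left_mono) auto
      then show ?thesis using Inr by (auto simp: r_def ln_div indicator_def algebra_simps)
    qed
    then show "m (Q -` {v}) * - ln (r v) \<le> m (Q -` {v}) * (ln 2 + real n * (a + \<theta>))
       + (m (Q -` {v}) * indicator (range Inr) v) * (real n * (D + \<bar>a\<bar> + \<theta>))"
      using mult_left_mono[OF _ nonneg[of "Q -` {v}"]] by (fastforce simp: algebra_simps)
  qed
  also have "\<dots> = ln 2 + real n * (a + \<theta>)
       + (\<Sum>v\<in>range Q. m (Q -` {v}) * indicator (range Inr) v) * (real n * (D + \<bar>a\<bar> + \<theta>))"
    using sum_law[OF finQ] by (simp add: sum.distrib sum_distrib_right[symmetric])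
  also have "(\<Sum>v\<in>range Q. m (Q -` {v}) * indicator (range Inr) v) = m {x. f x \<notin> U}"
  proof -
    have "{x. f x \<notin> U} = Q -` range Inr" by (auto simp: Q_def)
    then show ?thesis using vimage_sum[OF finQ, of "range Inr"] finQ
      by (auto simp: indicator_def sum.inter_restrict intro!: sum.cong)
  qed
  also have "ln 2 + real n * (a + \<theta>) + m {x. f x \<notin> U} * (real n * (D + \<bar>a\<bar> + \<theta>))
      \<le> ln 2 + real n * (a + \<theta>) + (m (X - G) + (real n * \<beta> + ln 2) / l) * (real n * (D + \<bar>a\<bar> + \<theta>))"
  proof -
    have "1 \<le> card (range (q 0))" using finite_q by (simp add: Suc_le_eq card_gt_0_iff)
    then have "0 \<le> D" unfolding D_def by simp
    then show ?thesis using uncovered \<theta> by (intro add_left_mono mult_right_mono) auto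
  qed
  finally show ?thesis by (simp add: D_def l_def)
qed

section \<open>Empirical measures of separated sets\<close>

text \<open>Tychonoff: functions into \<open>[0, 1]\<close> form a compact set. The neighbourhood
  filter of a cluster point, pulled back along \<open>u\<close> and met with \<open>F\<close>, plays
  the role of a convergent subnet.\<close>

lemma exists_pointwise_cluster_filter:
  fixes u :: "'l \<Rightarrow> 'b \<Rightarrow> real"
  assumes F: "F \<noteq> bot" and bnd: "\<And>L A. 0 \<le> u L A \<and> u L A \<le> 1"
  shows "\<exists>F' m. F' \<noteq> bot \<and> F' \<le> F \<and> (\<forall>A. ((\<lambda>L. u L A) \<longlongrightarrow> m A) F')"
proof -
  have "compactin (product_topology (\<lambda>_. euclidean) UNIV) (PiE UNIV (\<lambda>_::'b. {0..1::real}))"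
    by (simp add: compactin_PiE)
  then have comp: "compact (PiE UNIV (\<lambda>_::'b. {0..1::real}))"
    by (simp add: euclidean_product_topology)
  have "eventually (\<lambda>x. x \<in> PiE UNIV (\<lambda>_. {0..1})) (filtermap u F)"
    using bnd by (simp add: eventually_filtermap PiE_iff)
  moreover have "filtermap u F \<noteq> bot" using F by (simp add: filtermap_bot_iff)
  ultimately obtain m where m: "inf (nhds m) (filtermap u F) \<noteq> bot"
    using comp unfolding compact_filter by blast
  define F' where "F' = inf (filtercomap u (nhds m)) F"
  have "F' \<noteq> bot"
  proof
    assume "F' = bot"
    then have "eventually (\<lambda>_. False) F'" by simp
    then obtain P Q where P: "eventually P (filtercomap u (nhds m))" and Q: "eventually Q F"
      and PQ: "\<And>L. P L \<Longrightarrow> Q L \<Longrightarrow> False"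
      unfolding F'_def eventually_inf by blast
    obtain R where R: "eventually R (nhds m)" "\<And>L. R (u L) \<Longrightarrow> P L"
      using P unfolding eventually_filtercomap by blast
    have "eventually (\<lambda>y. \<not> R y) (filtermap u F)"
      unfolding eventually_filtermap using Q by eventually_elim (use PQ R in blast)
    then have "eventually (\<lambda>_. False) (inf (nhds m) (filtermap u F))"
      unfolding eventually_inf using R(1) by blast
    then show False using m by (simp add: eventually_False)
  qed
  moreover have "F' \<le> F" by (simp add: F'_def)
  moreover have "((\<lambda>L. u L A) \<longlongrightarrow> m A) F'" for A
  proof -
    have "filterlim u (nhds m) F'"
      unfolding F'_def by (rule filterlim_mono[OF filterlim_filtercomap order_refl inf_le1])
    moreover have "((\<lambda>x :: 'b \<Rightarrow> real. x A) \<longlongrightarrow> m A) (nhds m)"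
    proof (rule topological_tendstoI)
      fix S :: "real set" assume S: "open S" "m A \<in> S"
      have "open ((\<lambda>x :: 'b \<Rightarrow> real. x A) -` S)"
        using S(1) by (intro open_vimage) auto
      then show "eventually (\<lambda>x. x A \<in> S) (nhds m)"
        unfolding eventually_nhds using S(2) by blast
    qed
    ultimately show ?thesis by (rule filterlim_compose[rotated])
  qed
  ultimately show ?thesis by blast
qed

text \<open>Only the limit 0 needs care; there \<open>- 2 * sqrt x \<le> x * ln x \<le> 0\<close> on
  \<open>[0, 1]\<close> squeezes the product.\<close>

lemma tendsto_x_ln_x:
  fixes u :: "'l \<Rightarrow> real"
  assumes u: "(u \<longlongrightarrow> l) F" and bnd: "\<And>L. 0 \<le> u L \<and> u L \<le> 1" and l: "0 \<le> l"
  shows "((\<lambda>L. u L * ln (u L)) \<longlongrightarrow> l * ln l) F"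
proof (cases "l = 0")
  case False
  then show ?thesis using u by (intro tendsto_mult tendsto_ln) auto
next
  case True
  have "- (2 * sqrt x) \<le> x * ln x \<and> x * ln x \<le> 0" if "0 \<le> x" "x \<le> 1" for x :: real
  proof (cases "x = 0")
    case False
    then have x: "0 < x" using that by simp
    have "ln (1 / sqrt x) \<le> 1 / sqrt x - 1" using x by (intro ln_le_minus_one) simp
    then have "- ln x \<le> 2 * (1 / sqrt x)" using x by (simp add: ln_div ln_sqrt)
    then have "x * - ln x \<le> x * (2 * (1 / sqrt x))" using x by (intro mult_left_mono) auto
    also have "\<dots> = 2 * (x / sqrt x)" by simp
    also have "\<dots> = 2 * sqrt x" using x by (simp only: real_div_sqrt less_imp_le)
    finally have "x * - ln x \<le> 2 * sqrt x" .
    moreover have "x * ln x \<le> 0" using x that by (intro mult_nonneg_nonpos) auto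
    ultimately show ?thesis by simp
  qed simp
  then have bounds: "- (2 * sqrt (u L)) \<le> u L * ln (u L)" "u L * ln (u L) \<le> 0" for L
    using bnd by blast+
  have "((\<lambda>L. - (2 * sqrt (u L))) \<longlongrightarrow> 0) F"
    using tendsto_minus[OF tendsto_mult_left[OF tendsto_real_sqrt[OF u], of 2]] True by simp
  then have "((\<lambda>L. u L * ln (u L)) \<longlongrightarrow> 0) F"
    by (rule tendsto_sandwich[OF _ _ _ tendsto_const, rotated 2])
      (intro always_eventually allI bounds)+
  then show ?thesis using True by simp
qed

definition empirical :: "('a \<Rightarrow> 'a) \<Rightarrow> 'a set \<Rightarrow> nat \<Rightarrow> 'a set \<Rightarrow> real" where
  "empirical T E L A = (\<Sum>e\<in>E. \<Sum>s<L. indicator A ((T ^^ s) e)) / (real (card E) * real L)"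

lemma fa_prob_empirical:
  assumes "finite E" "E \<noteq> {}" "0 < L"
  shows "fa_prob (empirical T E L)"
proof
  show "0 \<le> empirical T E L A" for A
    by (auto simp: empirical_def intro!: divide_nonneg_nonneg sum_nonneg)
  show "empirical T E L UNIV = 1" using assms by (simp add: empirical_def)
  show "empirical T E L (A \<union> B) = empirical T E L A + empirical T E L B" if "A \<inter> B = {}" for A B
  proof -
    have "indicator (A \<union> B) x = indicator A x + (indicator B x :: real)" for x
      using that by (auto simp: indicator_def)
    then show ?thesis by (simp add: empirical_def sum.distrib add_divide_distrib)
  qed
qed

lemma sum_empirical_law:
  assumes "finite (range Q)"
  shows "(\<Sum>v\<in>range Q. empirical T E L (Q -` {v}) * \<phi> v)
    = (\<Sum>e\<in>E. \<Sum>s<L. \<phi> (Q ((T ^^ s) e))) / (real (card E) * real L)"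
proof -
  have pt: "(\<Sum>v\<in>range Q. indicator (Q -` {v}) x * \<phi> v) = \<phi> (Q x)" for x
  proof -
    have "(\<Sum>v\<in>range Q. indicator (Q -` {v}) x * \<phi> v) = (\<Sum>v\<in>range Q. if v = Q x then \<phi> v else 0)"
      by (rule sum.cong) (auto simp: indicator_def)
    then show ?thesis using assms by simp
  qed
  have "(\<Sum>e\<in>E. \<Sum>s<L. \<phi> (Q ((T ^^ s) e)))
      = (\<Sum>e\<in>E. \<Sum>s<L. \<Sum>v\<in>range Q. indicator (Q -` {v}) ((T ^^ s) e) * \<phi> v)"
    by (simp only: pt)
  also have "\<dots> = (\<Sum>e\<in>E. \<Sum>v\<in>range Q. \<Sum>s<L. indicator (Q -` {v}) ((T ^^ s) e) * \<phi> v)"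
    by (rule sum.cong[OF refl sum.swap])
  also have "\<dots> = (\<Sum>v\<in>range Q. \<Sum>e\<in>E. \<Sum>s<L. indicator (Q -` {v}) ((T ^^ s) e) * \<phi> v)"
    by (rule sum.swap)
  also have "\<dots> = (\<Sum>v\<in>range Q. (\<Sum>e\<in>E. \<Sum>s<L. indicator (Q -` {v}) ((T ^^ s) e)) * \<phi> v)"
    by (simp add: sum_distrib_right)
  finally have eq: "(\<Sum>e\<in>E. \<Sum>s<L. \<phi> (Q ((T ^^ s) e)))
      = (\<Sum>v\<in>range Q. (\<Sum>e\<in>E. \<Sum>s<L. indicator (Q -` {v}) ((T ^^ s) e)) * \<phi> v)" .
  have "(\<Sum>v\<in>range Q. a v / c * \<phi> v) = (\<Sum>v\<in>range Q. a v * \<phi> v) / c" for a and c :: real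
    by (simp add: sum_divide_distrib)
  then show ?thesis unfolding empirical_def eq by this
qed

text \<open>Along each orbit the two sums telescope to a first and a last term.\<close>

lemma empirical_almost_invariant:
  assumes "finite E" "E \<noteq> {}" "0 < L"
  shows "\<bar>empirical T E L (T -` A) - empirical T E L A\<bar> \<le> 1 / real L"
proof -
  have one: "\<bar>(\<Sum>s<L. indicator (T -` A) ((T ^^ s) e)) - (\<Sum>s<L. indicator A ((T ^^ s) e) :: real)\<bar> \<le> 1" for e
  proof -
    have "(\<Sum>s<L. indicator (T -` A) ((T ^^ s) e)) = (\<Sum>s<L. indicator A ((T ^^ Suc s) e) :: real)"
      by (intro sum.cong) (auto simp: indicator_def)
    then have "(\<Sum>s<L. indicator (T -` A) ((T ^^ s) e)) - (\<Sum>s<L. indicator A ((T ^^ s) e) :: real)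
        = indicator A ((T ^^ L) e) - indicator A ((T ^^ 0) e)"
      using sum_lessThan_telescope[of "\<lambda>s. indicator A ((T ^^ s) e) :: real" L]
      by (simp only: sum_subtractf)
    then show ?thesis by (auto simp: indicator_def)
  qed
  have "\<bar>(\<Sum>e\<in>E. \<Sum>s<L. indicator (T -` A) ((T ^^ s) e)) - (\<Sum>e\<in>E. \<Sum>s<L. indicator A ((T ^^ s) e) :: real)\<bar>
      \<le> (\<Sum>e\<in>E. 1)"
    unfolding sum_subtractf[symmetric, where A = E]
    by (rule order_trans[OF sum_abs sum_mono[OF one]])
  also have "\<dots> = real (card E)" by simp
  finally have le: "\<bar>(\<Sum>e\<in>E. \<Sum>s<L. indicator (T -` A) ((T ^^ s) e)) - (\<Sum>e\<in>E. \<Sum>s<L. indicator A ((T ^^ s) e) :: real)\<bar> \<le> real (card E)" .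
  have "0 < real (card E)" using assms by (simp add: card_gt_0_iff)
  then show ?thesis
    using le assms(3) by (simp add: empirical_def diff_divide_distrib[symmetric] field_simps)
qed

text \<open>Concavity of \<open>ln\<close>, obtained as the Gibbs inequality for the uniform law on
  \<open>E\<close> against \<open>x e / S\<close>.\<close>

lemma ln_card_le_sum:
  fixes x :: "'e \<Rightarrow> real"
  assumes "finite E" "E \<noteq> {}" and x: "\<And>e. e \<in> E \<Longrightarrow> 0 < x e" and S: "sum x E \<le> S"
  shows "ln (real (card E)) \<le> ln S - (\<Sum>e\<in>E. ln (x e)) / real (card E)"
proof -
  define k where "k = real (card E)"
  have k: "0 < k" using assms by (simp add: k_def card_gt_0_iff)
  have S0: "0 < S" using sum_pos[of E x] assms by force
  have "(\<Sum>e\<in>E. 1 / k * ln (x e / S)) \<le> (\<Sum>e\<in>E. 1 / k * ln (1 / k))"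
  proof (rule gibbs_inequality[where p = "\<lambda>_. 1 / k" and r = "\<lambda>e. x e / S"])
    show "(\<Sum>e\<in>E. x e / S) \<le> 1" using S S0 by (simp add: sum_divide_distrib[symmetric])
    show "0 \<le> x e / S" if "e \<in> E" for e using x[OF that] S0 by simp
    show "0 < x e / S" if "e \<in> E" "0 < 1 / k" for e using x[OF that(1)] S0 by simp
    show "(\<Sum>e\<in>E. 1 / k) = 1" using k by (simp add: k_def)
  qed (use assms k in auto)
  also have "\<dots> = - ln k" using k assms(2) by (simp add: ln_div k_def[symmetric])
  also have "(\<Sum>e\<in>E. 1 / k * ln (x e / S)) = (\<Sum>e\<in>E. ln (x e)) / k - ln S"
  proof -
    have "(\<Sum>e\<in>E. 1 / k * ln (x e / S)) = (\<Sum>e\<in>E. ln (x e) / k - ln S / k)"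
    proof (rule sum.cong[OF refl])
      show "1 / k * ln (x e / S) = ln (x e) / k - ln S / k" if "e \<in> E" for e
        using x[OF that] S0 by (simp add: ln_div diff_divide_distrib)
    qed
    also have "\<dots> = (\<Sum>e\<in>E. ln (x e)) / k - ln S"
      using k by (simp add: sum_subtractf sum_divide_distrib k_def[symmetric])
    finally show ?thesis .
  qed
  finally show ?thesis by (simp add: k_def)
qed

text \<open>
  For each residue \<open>s\<close> modulo \<open>n\<close>, a point of \<open>E\<close> is determined by its \<open>Q\<close>-names at the
  times congruent to \<open>s\<close> and by two names covering the two ends of \<open>[0, L)\<close>. Weighting each
  name by its empirical frequency and averaging over \<open>s\<close> gives the bound.
\<close>

lemma ln_card_separated_le:
  fixes X :: "'a::metric_space set"
  assumes E: "finite E" "E \<noteq> {}" "E \<subseteq> X"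
    and sep: "\<And>x y. x \<in> E \<Longrightarrow> y \<in> E \<Longrightarrow> (\<And>t. t < L \<Longrightarrow> dist ((T ^^ t) x) ((T ^^ t) y) < \<epsilon>) \<Longrightarrow> x = y"
    and TX: "T ` X \<subseteq> X" and finQ: "finite (range Q)"
    and diam: "\<And>x y t. x \<in> X \<Longrightarrow> y \<in> X \<Longrightarrow> Q x = Q y \<Longrightarrow> t < n \<Longrightarrow> dist ((T ^^ t) x) ((T ^^ t) y) < \<epsilon>"
    and n: "0 < n" "n \<le> L"
  shows "real n * ln (real (card E)) \<le> 2 * real n * ln (real (card (range Q))) + real L * ent (empirical T E L) Q"
proof -
  have L: "0 < L" using n by simp
  interpret fa_prob "empirical T E L" by (rule fa_prob_empirical[OF E(1,2) L])
  define p where "p v = empirical T E L (Q -` {v})" for v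
  define k where "k = real (card E)"
  define N where "N = real (card (range Q))"
  have k: "0 < k" using E by (simp add: k_def card_gt_0_iff)
  have p01: "0 \<le> p v" "p v \<le> 1" for v by (simp_all add: p_def nonneg le_one)
  have ppos: "0 < p (Q ((T ^^ t) e))" if "e \<in> E" "t < L" for e t
  proof -
    have "0 < (\<Sum>e'\<in>E. \<Sum>s<L. indicator (Q -` {Q ((T ^^ t) e)}) ((T ^^ s) e') :: real)"
    proof (rule sum_pos2[OF E(1) that(1)])
      show "0 < (\<Sum>s<L. indicator (Q -` {Q ((T ^^ t) e)}) ((T ^^ s) e) :: real)"
        by (rule sum_pos2[of _ t]) (use that in auto)
    qed (auto intro: sum_nonneg)
    then show ?thesis using k L unfolding p_def empirical_def k_def by simp
  qed
  define J where "J s = {t. t + n \<le> L \<and> t mod n = s}" for s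
  have finJ: "finite (J s)" for s by (rule finite_subset[of _ "{..L}"]) (auto simp: J_def)
  \<comment> \<open>The names at times \<open>0\<close> and \<open>L - n\<close> cover the two ends,
    where no full block of residue \<open>s\<close> need be available.\<close>
  define code where "code s e = ((Q e, Q ((T ^^ (L - n)) e)), restrict (\<lambda>t. Q ((T ^^ t) e)) (J s))" for s e
  have block: "dist ((T ^^ t) x) ((T ^^ t) y) < \<epsilon>"
    if "x \<in> E" "y \<in> E" "Q ((T ^^ t') x) = Q ((T ^^ t') y)" "t' \<le> t" "t < t' + n" for x y t t'
  proof -
    have eq: "(T ^^ (t - t')) ((T ^^ t') z) = (T ^^ t) z" for z
      using that(4) by (simp flip: funpow_add comp_apply[of "T ^^ (t - t')"])
    have "dist ((T ^^ (t - t')) ((T ^^ t') x)) ((T ^^ (t - t')) ((T ^^ t') y)) < \<epsilon>"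
      using that E funpow_mem[OF TX] by (intro diam) auto
    then show ?thesis by (simp only: eq)
  qed
  have inj: "inj_on (code s) E" if s: "s < n" for s
  proof (rule inj_onI, rule sep)
    fix x y t assume x: "x \<in> E" and y: "y \<in> E" and eq: "code s x = code s y" and t: "t < L"
    have e1: "Q ((T ^^ 0) x) = Q ((T ^^ 0) y)" and e2: "Q ((T ^^ (L - n)) x) = Q ((T ^^ (L - n)) y)"
      using eq by (auto simp: code_def)
    have e3: "Q ((T ^^ t') x) = Q ((T ^^ t') y)" if "t' \<in> J s" for t'
    proof -
      have "restrict (\<lambda>t. Q ((T ^^ t) x)) (J s) t' = restrict (\<lambda>t. Q ((T ^^ t) y)) (J s) t'"
        using eq by (simp add: code_def)
      then show ?thesis using that by simp
    qed
    consider "t < n" | "L - n \<le> t" | "n \<le> t" "t < L - n" by linarith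
    then show "dist ((T ^^ t) x) ((T ^^ t) y) < \<epsilon>"
    proof cases
      case 1
      then show ?thesis using block[OF x y e1] by simp
    next
      case 2
      then show ?thesis using block[OF x y e2] t n by simp
    next
      case 3
      \<comment> \<open>The last time up to \<open>t\<close> with residue \<open>s\<close>;
        \<open>t < L - n\<close> keeps its block inside \<open>[0, L)\<close>.\<close>
      define t' where "t' = t - (t - s) mod n"
      have lt: "(t - s) mod n < n" using n by simp
      have le: "(t - s) mod n \<le> t - s" by simp
      have "t' = s + (t - s) div n * n"
        using 3 s le minus_mod_eq_div_mult[of "t - s" n] unfolding t'_def by linarith
      then have "t' mod n = s" using s by simp
      then have "t' \<in> J s" using 3 lt unfolding J_def t'_def by auto
      then show ?thesis using block[OF x y e3] lt 3 unfolding t'_def by auto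
    qed
  qed (auto)
  have one: "ln k \<le> 2 * ln N - (\<Sum>e\<in>E. \<Sum>t\<in>J s. ln (p (Q ((T ^^ t) e)))) / k" if s: "s < n" for s
  proof -
    define x where "x e = (\<Prod>t\<in>J s. p (Q ((T ^^ t) e)))" for e
    have JL: "t < L" if "t \<in> J s" for t using that n by (simp add: J_def)
    have xpos: "0 < x e" if "e \<in> E" for e unfolding x_def using that JL ppos by (intro prod_pos) auto
    have lnx: "ln (x e) = (\<Sum>t\<in>J s. ln (p (Q ((T ^^ t) e))))" if "e \<in> E" for e
      unfolding x_def using that JL ppos finJ by (intro ln_prod) (auto simp: less_imp_neq[symmetric])
    \<comment> \<open>By injectivity the points are counted as distinct codes. Over all conceivable
      codes the product weights sum to 1 for each pair of end names, which leaves
      \<open>N * N\<close>.\<close>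
    have "sum x E = (\<Sum>c\<in>code s ` E. \<Prod>t\<in>J s. p (snd c t))"
      by (subst sum.reindex[OF inj[OF s]]) (simp add: x_def code_def)
    also have "\<dots> \<le> (\<Sum>c\<in>(range Q \<times> range Q) \<times> PiE (J s) (\<lambda>_. range Q). \<Prod>t\<in>J s. p (snd c t))"
    proof (rule sum_mono2)
      show "finite ((range Q \<times> range Q) \<times> PiE (J s) (\<lambda>_. range Q))"
        using finQ finJ by (intro finite_cartesian_product finite_PiE) auto
      show "code s ` E \<subseteq> (range Q \<times> range Q) \<times> PiE (J s) (\<lambda>_. range Q)"
        by (auto simp: code_def)
    qed (auto intro: prod_nonneg p01)
    also have "\<dots> = (\<Sum>c\<in>range Q \<times> range Q. \<Sum>g\<in>PiE (J s) (\<lambda>_. range Q). \<Prod>t\<in>J s. p (g t))"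
      by (simp add: sum.cartesian_product')
    also have "\<dots> = real (card (range Q \<times> range Q)) * (\<Prod>t\<in>J s. \<Sum>v\<in>range Q. p v)"
      using prod_sum_PiE[OF finJ[of s], of "\<lambda>_. range Q" "\<lambda>_ v. p v"] finQ by simp
    also have "\<dots> = N * N"
      using sum_law[OF finQ] by (simp add: p_def N_def card_cartesian_product)
    finally have "sum x E \<le> N * N" .
    from ln_card_le_sum[OF E(1,2) xpos this] have "ln k \<le> ln (N * N) - (\<Sum>e\<in>E. ln (x e)) / k"
      by (simp add: k_def)
    also have "ln (N * N) = 2 * ln N" by (simp add: ln_mult_pos N_def card_gt_0_iff finQ)
    finally show ?thesis using lnx by simp
  qed
  have "real n * ln k = (\<Sum>s<n. ln k)" by simp
  also have "\<dots> \<le> (\<Sum>s<n. 2 * ln N - (\<Sum>e\<in>E. \<Sum>t\<in>J s. ln (p (Q ((T ^^ t) e)))) / k)"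
    by (rule sum_mono) (use one in auto)
  also have "\<dots> = 2 * real n * ln N + (\<Sum>s<n. \<Sum>e\<in>E. \<Sum>t\<in>J s. - ln (p (Q ((T ^^ t) e)))) / k"
    by (simp add: sum_subtractf sum_divide_distrib sum_negf)
  also have "(\<Sum>s<n. \<Sum>e\<in>E. \<Sum>t\<in>J s. - ln (p (Q ((T ^^ t) e)))) = (\<Sum>e\<in>E. \<Sum>s<n. \<Sum>t\<in>J s. - ln (p (Q ((T ^^ t) e))))"
    by (rule sum.swap)
  \<comment> \<open>The sets \<open>J s\<close> are disjoint in \<open>s\<close>, so each time is
    counted at most once; the omitted times contribute nonnegative terms.\<close>
  also have "\<dots> \<le> (\<Sum>e\<in>E. \<Sum>t<L. - ln (p (Q ((T ^^ t) e))))"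
  proof (rule sum_mono)
    fix e assume e: "e \<in> E"
    have "(\<Sum>s<n. \<Sum>t\<in>J s. - ln (p (Q ((T ^^ t) e)))) = (\<Sum>t\<in>(\<Union>s<n. J s). - ln (p (Q ((T ^^ t) e))))"
      using finJ by (subst sum.UNION_disjoint) (auto simp: J_def)
    also have "\<dots> \<le> (\<Sum>t<L. - ln (p (Q ((T ^^ t) e))))"
    proof (rule sum_mono2)
      show "(\<Union>s<n. J s) \<subseteq> {..<L}" using n by (auto simp: J_def)
      show "0 \<le> - ln (p (Q ((T ^^ t) e)))" if "t \<in> {..<L} - (\<Union>s<n. J s)" for t
        using that ppos[OF e] p01 by auto
    qed simp
    finally show "(\<Sum>s<n. \<Sum>t\<in>J s. - ln (p (Q ((T ^^ t) e)))) \<le> (\<Sum>t<L. - ln (p (Q ((T ^^ t) e))))" .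
  qed
  also have "(\<Sum>e\<in>E. \<Sum>t<L. - ln (p (Q ((T ^^ t) e)))) / k = real L * ent (empirical T E L) Q"
    using sum_empirical_law[OF finQ, of T E L "\<lambda>v. - ln (p v)"] L
    by (simp add: ent_def p_def k_def sum_negf field_simps)
  finally show ?thesis using k unfolding k_def N_def by (simp add: divide_right_mono)
qed

text \<open>Cluster point of the empirical measures along lengths that carry large separated sets.
  The invariance defect and, after division by \<open>L\<close>, the boundary term of
  \<open>ln_card_separated_le\<close> are of order \<open>1 / L\<close>, and the entropy of a finite
  partition is continuous in its masses.\<close>

lemma exists_invariant_limit:
  fixes X :: "'a::metric_space set" and T :: "'a \<Rightarrow> 'a" and b :: real
  assumes ne: "X \<noteq> {}" and TX: "T ` X \<subseteq> X"
    and sep: "\<exists>\<^sub>F L in sequentially. \<exists>E. finite E \<and> E \<noteq> {} \<and> E \<subseteq> X \<and> exp (real L * b) \<le> real (card E) \<and>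
      (\<forall>x\<in>E. \<forall>y\<in>E. (\<forall>t<L. dist ((T ^^ t) x) ((T ^^ t) y) < \<epsilon>) \<longrightarrow> x = y)"
  shows "\<exists>m. fa_prob m \<and> m X = 1 \<and> (\<forall>A. m (T -` A) = m A) \<and>
    (\<forall>n>0. \<forall>Q :: 'a \<Rightarrow> 'b. finite (range Q) \<longrightarrow>
      (\<forall>x\<in>X. \<forall>y\<in>X. Q x = Q y \<longrightarrow> (\<forall>t<n. dist ((T ^^ t) x) ((T ^^ t) y) < \<epsilon>)) \<longrightarrow> real n * b \<le> ent m Q)"
proof -
  define close where "close L x y \<longleftrightarrow> (\<forall>t<L. dist ((T ^^ t) x) ((T ^^ t) y) < \<epsilon>)" for L x y
  define good where "good L E \<longleftrightarrow> finite E \<and> E \<noteq> {} \<and> E \<subseteq> X \<and> exp (real L * b) \<le> real (card E) \<and>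
      (\<forall>x\<in>E. \<forall>y\<in>E. close L x y \<longrightarrow> x = y)" for L E
  obtain x0 where x0: "x0 \<in> X" using ne by blast
  define E where "E L = (if \<exists>E. good L E then SOME E. good L E else {x0})" for L
  have E_good: "good L (E L)" if "\<exists>E. good L E" for L
    using that someI_ex[of "good L"] by (simp add: E_def)
  have E: "finite (E L)" "E L \<noteq> {}" "E L \<subseteq> X" for L
  proof -
    have "finite (E L) \<and> E L \<noteq> {} \<and> E L \<subseteq> X"
    proof (cases "\<exists>E. good L E")
      case True
      show ?thesis using E_good[OF True] unfolding good_def by (elim conjE) (intro conjI)
    next
      case False
      then show ?thesis using x0 by (simp add: E_def)
    qed
    then show "finite (E L)" "E L \<noteq> {}" "E L \<subseteq> X" by simp_all
  qed
  \<comment> \<open>Restriction to the lengths with separated sets; it is a proper filter because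
    these occur frequently.\<close>
  define F where "F = inf sequentially (principal {L. \<exists>E. good L E})"
  have "F \<noteq> bot"
    using sep unfolding F_def close_def[symmetric] good_def[symmetric] frequently_def
    by (simp add: trivial_limit_def eventually_inf_principal)
  define u where "u L = empirical T (E L) L" for L
  have fa: "fa_prob (u L)" if "0 < L" for L unfolding u_def by (rule fa_prob_empirical[OF E(1,2) that])
  have bnd: "0 \<le> u L A \<and> u L A \<le> 1" for L A
  proof (cases "L = 0")
    \<comment> \<open>At \<open>L = 0\<close> division by 0 makes \<open>empirical\<close>
      vanish.\<close>
    case True
    then show ?thesis by (simp add: u_def empirical_def)
  next
    case False
    then show ?thesis using fa_prob.nonneg[OF fa] fa_prob.le_one[OF fa] by auto
  qed
  obtain F' m where F': "F' \<noteq> bot" "F' \<le> F" and lim: "\<And>A. ((\<lambda>L. u L A) \<longlongrightarrow> m A) F'"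
    using exists_pointwise_cluster_filter[of F u, OF \<open>F \<noteq> bot\<close> bnd] by blast
  have seq: "eventually P F'" if "eventually P sequentially" for P
    using that F'(2) unfolding F_def by (meson filter_leD inf_le1)
  have pos: "eventually (\<lambda>L. 0 < L) F'" by (rule seq[OF eventually_gt_at_top])
  have ev_good: "eventually (\<lambda>L. good L (E L)) F'"
  proof -
    have "eventually (\<lambda>L. \<exists>E. good L E) F" unfolding F_def eventually_inf_principal by simp
    then have "eventually (\<lambda>L. \<exists>E. good L E) F'" using F'(2) filter_leD by blast
    then show ?thesis by eventually_elim (rule E_good)
  qed
  have inv0: "((\<lambda>L. c / real L) \<longlongrightarrow> 0) F'" for c
    using lim_const_over_n[of c] unfolding tendsto_def by (blast intro: seq)
  have m01: "0 \<le> m A" for A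
    using bnd by (intro tendsto_lowerbound[OF lim _ F'(1)]) auto
  have unique: "m A = c" if "eventually (\<lambda>L. u L A = c) F'" for A c
    using tendsto_unique[OF F'(1) lim tendsto_eventually[OF that]] .
  have "fa_prob m"
  proof
    show "m UNIV = 1"
      by (rule unique, use pos in eventually_elim) (rule fa_prob.total[OF fa])
    show "m (A \<union> B) = m A + m B" if "A \<inter> B = {}" for A B
    proof (rule tendsto_unique[OF F'(1) lim])
      have "eventually (\<lambda>L. u L A + u L B = u L (A \<union> B)) F'"
        using pos by eventually_elim (simp add: fa_prob.additive[OF fa that])
      then show "((\<lambda>L. u L (A \<union> B)) \<longlongrightarrow> m A + m B) F'"
        by (rule Lim_transform_eventually[OF tendsto_add[OF lim lim]])
    qed
  qed (rule m01)
  moreover have "m X = 1"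
  proof (rule unique, use pos in eventually_elim)
    fix L :: nat assume L: "0 < L"
    have "(\<Sum>e\<in>E L. \<Sum>s<L. indicator X ((T ^^ s) e)) = (\<Sum>e\<in>E L. \<Sum>s<L. 1 :: real)"
      using E(3)[of L] funpow_mem[OF TX] by (intro sum.cong refl) (auto simp: indicator_def)
    then show "u L X = 1" using E(1,2)[of L] L by (simp add: u_def empirical_def)
  qed
  moreover have "m (T -` A) = m A" for A
  proof -
    have "((\<lambda>L. u L (T -` A) - u L A) \<longlongrightarrow> 0) F'"
    proof (rule Lim_null_comparison[OF _ inv0[of 1]])
      show "eventually (\<lambda>L. norm (u L (T -` A) - u L A) \<le> 1 / real L) F'"
        using pos by eventually_elim (simp add: u_def empirical_almost_invariant[OF E(1,2)])
    qed
    from tendsto_unique[OF F'(1) tendsto_diff[OF lim lim] this] show ?thesis by simp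
  qed
  moreover have "real n * b \<le> ent m Q"
    if n: "0 < n" and fin: "finite (range Q)"
      and diam: "\<forall>x\<in>X. \<forall>y\<in>X. Q x = Q y \<longrightarrow> (\<forall>t<n. dist ((T ^^ t) x) ((T ^^ t) y) < \<epsilon>)"
    for n and Q :: "'a \<Rightarrow> 'b"
  proof -
    have "((\<lambda>L. ent (u L) Q) \<longlongrightarrow> ent m Q) F'"
      unfolding ent_def by (intro tendsto_minus tendsto_sum tendsto_x_ln_x lim bnd m01)
    then have "((\<lambda>L. (2 * real n * ln (real (card (range Q)))) / real L + ent (u L) Q) \<longlongrightarrow> 0 + ent m Q) F'"
      by (intro tendsto_add inv0)
    moreover have "eventually (\<lambda>L. real n * b \<le> (2 * real n * ln (real (card (range Q)))) / real L + ent (u L) Q) F'"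
      using pos ev_good seq[OF eventually_ge_at_top[of n]]
    proof eventually_elim
      fix L assume L: "0 < L" and g: "good L (E L)" and nL: "n \<le> L"
      have "real L * b \<le> ln (real (card (E L)))"
        using g E(1,2)[of L] by (simp add: good_def ln_ge_iff card_gt_0_iff)
      then have "real n * (real L * b) \<le> real n * ln (real (card (E L)))" by (intro mult_left_mono) auto
      also have "\<dots> \<le> 2 * real n * ln (real (card (range Q))) + real L * ent (u L) Q"
        unfolding u_def
      proof (rule ln_card_separated_le[OF E[of L] _ TX fin _ n nL, where \<epsilon> = \<epsilon>])
        show "x = y" if "x \<in> E L" "y \<in> E L" "\<And>t. t < L \<Longrightarrow> dist ((T ^^ t) x) ((T ^^ t) y) < \<epsilon>" for x y
        proof -
          have "close L x y" unfolding close_def using that(3) by (intro allI impI)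
          then show ?thesis using g that(1,2) unfolding good_def by blast
        qed
      qed (rule diam[rule_format])
      finally show "real n * b \<le> (2 * real n * ln (real (card (range Q)))) / real L + ent (u L) Q"
        using L by (simp add: field_simps)
    qed
    ultimately have "real n * b \<le> 0 + ent m Q" by (rule tendsto_lowerbound[OF _ _ F'(1)])
    then show ?thesis by simp
  qed
  ultimately show ?thesis by (intro exI[of _ m] conjI allI impI) 
qed

section \<open>Stable sets of large entropy\<close>

lemma exists_finite_code:
  fixes X :: "'a::metric_space set"
  assumes "compact X" and d: "0 < d"
  shows "\<exists>q :: 'a \<Rightarrow> nat. finite (range q) \<and> (\<forall>x\<in>X. \<forall>y\<in>X. q x = q y \<longrightarrow> dist x y \<le> d)"
proof -
  obtain k where k: "finite k" "X \<subseteq> (\<Union>c\<in>k. ball c (d / 2))"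
    using compact_imp_seq_compact[OF assms(1)] seq_compact_imp_totally_bounded d half_gt_zero by metis
  have "\<exists>c. x \<in> X \<longrightarrow> c \<in> k \<and> dist c x < d / 2" for x
  proof (cases "x \<in> X")
    case True
    then have "x \<in> (\<Union>c\<in>k. ball c (d / 2))" using k(2) by (rule subsetD[rotated])
    then show ?thesis by simp blast
  qed simp
  then obtain p where p: "\<And>x. x \<in> X \<Longrightarrow> p x \<in> k \<and> dist (p x) x < d / 2" by metis
  obtain f :: "'a \<Rightarrow> nat" where f: "inj_on f k" using finite_imp_inj_to_nat_seg[OF k(1)] by blast
  define q where "q x = (if x \<in> X then f (p x) else 0)" for x
  have "q x \<in> insert 0 (f ` k)" for x using p[of x] by (simp add: q_def)
  then have "range q \<subseteq> insert 0 (f ` k)" by (intro image_subsetI)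
  then have "finite (range q)" using k(1) by (meson finite.insertI finite_imageI finite_subset)
  moreover have "dist x y \<le> d" if "x \<in> X" "y \<in> X" "q x = q y" for x y
  proof -
    have "f (p x) = f (p y)" using that by (simp add: q_def)
    then have "p x = p y" by (rule inj_onD[OF f]) (use p that in blast)+
    then show ?thesis using p[OF that(1)] p[OF that(2)] dist_triangle3[of x y "p x"] by simp
  qed
  ultimately show ?thesis by blast
qed

section \<open>Bowen balls, spanning sets and separated sets\<close>

lemma bowen_dist_less_iff: "0 < n \<Longrightarrow> bowen_dist T n x y < r \<longleftrightarrow> (\<forall>t<n. dist ((T ^^ t) x) ((T ^^ t) y) < r)"
  by (simp add: bowen_dist_def Max_less_iff) (meson atLeastLessThan_iff bot_nat_0.extremum)

lemma spanning_number_least: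
  "finite E \<Longrightarrow> spanning X T Z n \<epsilon> E \<Longrightarrow> spanning_number X T Z n \<epsilon> \<le> card E"
  unfolding spanning_number_def by (rule Least_le) blast

text \<open>One representative for each length-\<open>n\<close> name of a code of mesh
  \<open>\<epsilon> / 2\<close> gives a finite spanning set, so the \<open>LEAST\<close> is
  attained.\<close>

lemma exists_finite_spanning:
  fixes X :: "'a::metric_space set"
  assumes X: "compact X" and TX: "T ` X \<subseteq> X" and ZX: "Z \<subseteq> X" and n: "0 < n" and \<epsilon>: "0 < \<epsilon>"
  shows "\<exists>E. finite E \<and> card E = spanning_number X T Z n \<epsilon> \<and> spanning X T Z n \<epsilon> E"
proof -
  have "0 < \<epsilon> / 2" using \<epsilon> by simp
  from exists_finite_code[OF X this] obtain q :: "'a \<Rightarrow> nat" where q: "finite (range q)"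
      "\<And>x y. x \<in> X \<Longrightarrow> y \<in> X \<Longrightarrow> q x = q y \<Longrightarrow> dist x y \<le> \<epsilon> / 2" by blast
  define f where "f = itinerary T (\<lambda>_. q) ({0} \<times> {0..<n})"
  have "finite (range f)" unfolding f_def by (rule finite_range_itinerary[OF q(1)]) simp
  then have fin: "finite (f ` X)" by (rule finite_subset[OF image_mono[OF subset_UNIV]])
  have "\<exists>x. w \<in> f ` X \<longrightarrow> x \<in> X \<and> f x = w" for w by blast
  then obtain p where p: "\<And>w. w \<in> f ` X \<Longrightarrow> p w \<in> X \<and> f (p w) = w" by metis
  have "spanning X T Z n \<epsilon> (p ` f ` X)"
    unfolding spanning_def
  proof (intro conjI ballI)
    show "p ` f ` X \<subseteq> X" by (intro image_subsetI) (simp add: p)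
    fix x assume "x \<in> Z"
    then have x: "x \<in> X" using ZX by blast
    have "dist ((T ^^ t) x) ((T ^^ t) (p (f x))) < \<epsilon>" if "t < n" for t
    proof -
      define x' where "x' = p (f x)"
      have x': "x' \<in> X" "f x' = f x" using p[of "f x"] x by (simp_all add: x'_def)
      have "(0, t) \<in> {0} \<times> {0..<n}" using that by simp
      then have "q ((T ^^ t) x) = q ((T ^^ t) x')"
        using x'(2)[symmetric, unfolded f_def itinerary_eq_iff, THEN bspec] by blast
      then have "dist ((T ^^ t) x) ((T ^^ t) x') \<le> \<epsilon> / 2"
        by (intro q(2) funpow_mem[OF TX] x x'(1))
      then show ?thesis using \<epsilon> unfolding x'_def by simp
    qed
    then show "\<exists>y\<in>p ` f ` X. bowen_dist T n x y < \<epsilon>"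
      unfolding bowen_dist_less_iff[OF n] using x by blast
  qed
  moreover have "finite (p ` f ` X)" using fin by (rule finite_imageI)
  ultimately have "\<exists>k E. finite E \<and> card E = k \<and> spanning X T Z n \<epsilon> E" by blast
  from LeastI_ex[OF this] show ?thesis unfolding spanning_number_def .
qed

text \<open>A set with fewer points than the spanning number is not spanning, so a point far from
  all its members can be added.\<close>

lemma exists_separated_set:
  assumes n: "0 < n" and k: "k \<le> spanning_number X T X n \<epsilon>"  and \<epsilon>: "0 < \<epsilon>"
  shows "\<exists>E. finite E \<and> E \<subseteq> X \<and> card E = k \<and>
    (\<forall>x\<in>E. \<forall>y\<in>E. (\<forall>t<n. dist ((T ^^ t) x) ((T ^^ t) y) < \<epsilon>) \<longrightarrow> x = y)"
  using k
proof (induction k)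
  case 0
  show ?case by (intro exI[of _ "{}"]) auto
next
  case (Suc k)
  then obtain E where E: "finite E" "E \<subseteq> X" "card E = k"
    "\<forall>x\<in>E. \<forall>y\<in>E. (\<forall>t<n. dist ((T ^^ t) x) ((T ^^ t) y) < \<epsilon>) \<longrightarrow> x = y" by auto
  have "\<not> spanning X T X n \<epsilon> E" using spanning_number_least[OF E(1)] E(3) Suc.prems by fastforce
  then obtain x where x: "x \<in> X" "\<And>y. y \<in> E \<Longrightarrow> \<not> (\<forall>t<n. dist ((T ^^ t) x) ((T ^^ t) y) < \<epsilon>)"
    using E(2) unfolding spanning_def bowen_dist_less_iff[OF n] by blast
  have "x \<notin> E" using x(2)[of x] \<epsilon> by auto
  moreover have "\<not> (\<forall>t<n. dist ((T ^^ t) y) ((T ^^ t) x) < \<epsilon>)" if "y \<in> E" for y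
    using x(2)[OF that] by (simp add: dist_commute)
  ultimately show ?case using E x
    by (intro exI[of _ "insert x E"]) (metis (no_types, lifting) card_insert_disjoint finite.insertI insert_iff insert_subset)
qed

lemma continuous_on_funpow:
  assumes "continuous_on X T" "T ` X \<subseteq> X"
  shows "continuous_on X (T ^^ t)"
proof (induction t)
  case (Suc t)
  have "(T ^^ t) ` X \<subseteq> X" using funpow_mem[OF assms(2)] by auto
  then have "continuous_on X (T \<circ> (T ^^ t))"
    using Suc assms(1) by (intro continuous_on_compose) (auto intro: continuous_on_subset)
  then show ?case by simp
qed simp

text \<open>If a finite set covered \<open>Z\<close>, uncovered points of the fibers would
  subconverge to a point of \<open>Z\<close>, and its strict inequalities at the finitely many times
  below \<open>n\<close> would already hold near the limit. Used for closedness in the base point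
  with a fixed window, and for growing windows with a fixed base point.\<close>

lemma not_coverable_limit:
  fixes X :: "'a::metric_space set"
  assumes X: "compact X" and T: "continuous_on X T" and TX: "T ` X \<subseteq> X"
    and x: "\<And>j. \<xi> j \<in> X" "\<xi> \<longlonglongrightarrow> x"
    and nc: "\<And>j. \<not> coverable X T n \<epsilon> B (fiber X T \<delta> (Y j) (\<xi> j))"
    and Z: "\<And>y. y \<in> X \<Longrightarrow> (\<And>i t. eventually (\<lambda>j. (i, t) \<in> Y j) sequentially \<Longrightarrow> dist ((T ^^ t) x) ((T ^^ t) y) \<le> \<delta> i) \<Longrightarrow> y \<in> Z"
  shows "\<not> coverable X T n \<epsilon> B Z"
proof
  define close where "close y z \<longleftrightarrow> (\<forall>t<n. dist ((T ^^ t) y) ((T ^^ t) z) < \<epsilon>)" for y z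
  assume "coverable X T n \<epsilon> B Z"
  then obtain E where E: "finite E" "E \<subseteq> X" "real (card E) \<le> B" "\<forall>y\<in>Z. \<exists>z\<in>E. close y z"
    unfolding coverable_def close_def[symmetric] by blast
  have "\<exists>y. y \<in> fiber X T \<delta> (Y j) (\<xi> j) \<and> \<not> (\<exists>z\<in>E. close y z)" for j
    using nc[of j] E(1-3) unfolding coverable_def close_def[symmetric] by blast
  then obtain \<eta> where \<eta>: "\<And>j. \<eta> j \<in> fiber X T \<delta> (Y j) (\<xi> j)"
    and bad: "\<And>j. \<not> (\<exists>z\<in>E. close (\<eta> j) z)" by metis
  have \<eta>X: "\<eta> j \<in> X" for j using \<eta>[of j] by (simp add: fiber_def)
  obtain y r where y: "y \<in> X" "strict_mono r" "(\<eta> \<circ> r) \<longlonglongrightarrow> y"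
    using seq_compactE[OF compact_imp_seq_compact[OF X], of \<eta>] \<eta>X by blast
  have xX: "x \<in> X" using closed_sequentially[OF compact_imp_closed[OF X] x] .
  have limy: "(\<lambda>j. (T ^^ t) (\<eta> (r j))) \<longlonglongrightarrow> (T ^^ t) y" for t
    using continuous_on_tendsto_compose[OF continuous_on_funpow[OF T TX] y(3) y(1) always_eventually] \<eta>X
    by (simp add: comp_def)
  have limx: "(\<lambda>j. (T ^^ t) (\<xi> (r j))) \<longlonglongrightarrow> (T ^^ t) x" for t
    using continuous_on_tendsto_compose[OF continuous_on_funpow[OF T TX] LIMSEQ_subseq_LIMSEQ[OF x(2) y(2)] xX always_eventually] x(1)
    by (simp add: comp_def)
  have "y \<in> Z"
  proof (rule Z[OF y(1)])
    fix i t assume "eventually (\<lambda>j. (i, t) \<in> Y j) sequentially"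
    then have "eventually (\<lambda>j. (i, t) \<in> Y (r j)) sequentially"
      by (rule eventually_subseq[OF y(2)])
    then have "eventually (\<lambda>j. dist ((T ^^ t) (\<xi> (r j))) ((T ^^ t) (\<eta> (r j))) \<le> \<delta> i) sequentially"
    proof eventually_elim
      fix j assume "(i, t) \<in> Y (r j)"
      then show "dist ((T ^^ t) (\<xi> (r j))) ((T ^^ t) (\<eta> (r j))) \<le> \<delta> i"
        using \<eta>[of "r j"] unfolding fiber_def by blast
    qed
    then show "dist ((T ^^ t) x) ((T ^^ t) y) \<le> \<delta> i"
      by (rule tendsto_upperbound[OF tendsto_dist[OF limx limy]]) simp
  qed
  then obtain z where z: "z \<in> E" "\<And>t. t < n \<Longrightarrow> dist ((T ^^ t) y) ((T ^^ t) z) < \<epsilon>"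
    using E(4) unfolding close_def by blast
  have "eventually (\<lambda>j. dist ((T ^^ t) (\<eta> (r j))) ((T ^^ t) z) < \<epsilon>) sequentially" if "t < n" for t
    using order_tendstoD(2)[OF tendsto_dist[OF limy tendsto_const] z(2)[OF that]] .
  then have "eventually (\<lambda>j. \<forall>t\<in>{..<n}. dist ((T ^^ t) (\<eta> (r j))) ((T ^^ t) z) < \<epsilon>) sequentially"
    by (intro eventually_ball_finite) auto
  from eventually_happens[OF this] obtain j where "close (\<eta> (r j)) z"
    unfolding close_def by auto
  then show False using bad[of "r j"] z(1) by blast
qed

text \<open>The intersection of the fibers over all windows lies in the stable set. Noncoverability
  is therefore proved for finite windows, on sets of mass at least \<open>c\<close> at every scale,
  and then carried to the limit.\<close>

lemma stable_set_coverable_fails: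
  fixes X :: "'a::metric_space set"
  assumes X: "compact X" and ne: "X \<noteq> {}" and T: "continuous_on X T" and TX: "T ` X \<subseteq> X"
    and \<epsilon>: "0 < \<epsilon>" and h: "ereal b < h_top X T X \<epsilon>" and ab: "a < b"
  shows "\<exists>x\<in>X. \<exists>\<^sub>F n in sequentially. \<not> coverable X T n (\<epsilon> / 4) (exp (real n * a)) (stable_set X T x)"
proof -
  define close where "close L x y \<longleftrightarrow> (\<forall>t<L. dist ((T ^^ t) x) ((T ^^ t) y) < \<epsilon>)" for L x y
  have "\<exists>\<^sub>F L in sequentially. ereal b < ereal (ln (real (spanning_number X T X L \<epsilon>)) / real L)"
  proof (rule ccontr)
    assume "\<not> ?thesis"
    then have "h_top X T X \<epsilon> \<le> ereal b"
      unfolding h_top_def by (intro Limsup_bounded) (simp add: frequently_def not_less)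
    then show False using h by simp
  qed
  then have freq: "\<exists>\<^sub>F L in sequentially. ereal b < ereal (ln (real (spanning_number X T X L \<epsilon>)) / real L) \<and> 0 < L"
    using eventually_gt_at_top[of "0 :: nat"] by (rule frequently_eventually_frequently)
  have sep: "\<exists>\<^sub>F L in sequentially. \<exists>E. finite E \<and> E \<noteq> {} \<and> E \<subseteq> X \<and> exp (real L * b) \<le> real (card E) \<and>
      (\<forall>x\<in>E. \<forall>y\<in>E. close L x y \<longrightarrow> x = y)"
    using freq
  proof (rule frequently_elim1)
    fix L assume "ereal b < ereal (ln (real (spanning_number X T X L \<epsilon>)) / real L) \<and> 0 < L"
    then have L: "0 < L" and b: "b < ln (real (spanning_number X T X L \<epsilon>)) / real L" by simp_all
    obtain E where E: "finite E" "E \<subseteq> X" "card E = spanning_number X T X L \<epsilon>"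
      "\<forall>x\<in>E. \<forall>y\<in>E. close L x y \<longrightarrow> x = y"
      using exists_separated_set[OF L order_refl \<epsilon>, of X T] unfolding close_def[symmetric] by blast
    obtain E0 where E0: "card E0 = spanning_number X T X L \<epsilon>" "finite E0" "spanning X T X L \<epsilon> E0"
      using exists_finite_spanning[OF X TX order_refl L \<epsilon>] by blast
    have "E0 \<noteq> {}" using E0(3) ne unfolding spanning_def by blast
    then have pos: "0 < spanning_number X T X L \<epsilon>" using E0 by (metis card_gt_0_iff)
    have "real L * b < ln (real (spanning_number X T X L \<epsilon>))"
      using b L by (simp add: field_simps)
    then have "exp (real L * b) \<le> real (card E)" using pos E(3) ln_ge_iff[of "real (card E)" "real L * b"] by simp
    moreover have "E \<noteq> {}" using pos E(3) by auto
    ultimately show "\<exists>E. finite E \<and> E \<noteq> {} \<and> E \<subseteq> X \<and> exp (real L * b) \<le> real (card E) \<and>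
      (\<forall>x\<in>E. \<forall>y\<in>E. close L x y \<longrightarrow> x = y)" using E by blast
  qed
  \<comment> \<open>The mesh tends to 0, which makes orbits agreeing at all levels asymptotic; level
    0 has the mesh \<open>\<epsilon> / 4\<close> required by the entropy bound.\<close>
  define \<delta> where "\<delta> i = \<epsilon> / 4 / (real i + 1)" for i :: nat
  have "0 < \<delta> i" for i using \<epsilon> by (simp add: \<delta>_def)
  then have "\<exists>q :: 'a \<Rightarrow> nat. finite (range q) \<and> (\<forall>x\<in>X. \<forall>y\<in>X. q x = q y \<longrightarrow> dist x y \<le> \<delta> i)" for i
    by (rule exists_finite_code[OF X])
  then obtain q :: "nat \<Rightarrow> 'a \<Rightarrow> nat" where q: "\<And>i. finite (range (q i))"
      "\<And>i x y. x \<in> X \<Longrightarrow> y \<in> X \<Longrightarrow> q i x = q i y \<Longrightarrow> dist x y \<le> \<delta> i" by metis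
  obtain m where m: "fa_prob m" "m X = 1" "\<forall>A. m (T -` A) = m A"
    and lower: "\<forall>n>0. \<forall>Q :: 'a \<Rightarrow> 'a + (nat \<times> nat \<Rightarrow> nat). finite (range Q) \<longrightarrow>
      (\<forall>x\<in>X. \<forall>y\<in>X. Q x = Q y \<longrightarrow> close n x y) \<longrightarrow> real n * b \<le> ent m Q"
    using exists_invariant_limit[OF ne TX, of b \<epsilon>] sep unfolding close_def[symmetric] by blast
  interpret fa_prob m by fact
  interpret invariant_fa_prob m T q
    by unfold_locales (use m(3) q(1) in blast)+
  \<comment> \<open>The gap \<open>b - a = 4 * \<theta>\<close> is spent in four parts: the number
    of chosen fibers, a term \<open>ln 2\<close>, the dependence error \<open>c * M\<close>, and the
    remaining lower bound for \<open>m (C k K) * M\<close>. The errors \<open>\<beta> k\<close> are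
    geometric with sum at most \<open>\<theta> * c / 2\<close>.\<close>
  define \<theta> where "\<theta> = (b - a) / 4"
  define M where "M = ln (real (card (range (q 0)))) + \<bar>a\<bar> + \<theta>"
  define c where "c = \<theta> / M"
  define \<beta> where "\<beta> k = \<theta> * c / 2 * (1 / 2) ^ Suc k" for k
  have \<theta>: "0 < \<theta>" using ab by (simp add: \<theta>_def)
  have "1 \<le> card (range (q 0))" using q(1) by (simp add: Suc_le_eq card_gt_0_iff)
  then have M: "0 < M" unfolding M_def using \<theta> by (simp add: add_nonneg_pos)
  have c: "0 < c" using \<theta> M by (simp add: c_def)
  have \<beta>: "0 < \<beta> k" for k using \<theta> c by (simp add: \<beta>_def)
  \<comment> \<open>For scales above \<open>N0\<close> the first summand gives
    \<open>ln 2 \<le> n k * \<theta> * c / 2\<close> inside the dependence error, the second gives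
    \<open>ln 2 \<le> n k * \<theta>\<close> for the separate \<open>ln 2\<close>.\<close>
  obtain N0 :: nat where N0: "2 / (\<theta> * c) + 1 / \<theta> < real N0" using reals_Archimedean2 by blast
  obtain n where n: "strict_mono n" "N0 < n 0" "\<And>k. n k dvd n (Suc k)"
    "\<And>k r. real r * ent m (itinerary T q ({..k} \<times> {0..<n k})) - ent m (itinerary T q ({..k} \<times> {0..<r * n k}))
       \<le> real r * real (n k) * \<beta> k"
    using names.exists_scales[of \<beta> N0, OF \<beta>] by blast
  have n0: "0 < n 0" using n(2) by simp
  have n_large: "N0 < n k" for k
    using n(2) strict_mono_less_eq[OF n(1), of 0 k] by simp
  have past_future: "names.mi ({0} \<times> {0..<n k}) (tail_window n K k E) \<le> real (n k) * (\<theta> * c / 2)" if "k \<le> K" for k K E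
  proof -
    have "names.mi ({0} \<times> {0..<n k}) (tail_window n K k E) \<le> names.mi ({..k} \<times> {0..<n k}) (tail_window n K k E)"
      by (rule names.mi_mono) auto
    also have "\<dots> \<le> real (n k) * (\<Sum>l=k..K. \<beta> l)"
      by (rule names.mi_past_future[OF n(1) n0 n(3,4) that])
    also have "\<dots> \<le> real (n k) * (\<theta> * c / 2)"
    proof (rule mult_left_mono)
      have "(\<Sum>l=k..K. \<beta> l) \<le> (\<Sum>l<Suc K. \<beta> l)"
        by (rule sum_mono2) (use \<beta> in \<open>auto intro: less_imp_le\<close>)
      also have "\<dots> = \<theta> * c / 2 * (\<Sum>l<Suc K. (1 / 2) ^ Suc l)"
        by (simp only: \<beta>_def sum_distrib_left)
      also have "(\<Sum>l<Suc K. (1 / 2) ^ Suc l) = 1 - (1 / 2 :: real) ^ Suc K"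
        by (induction K) auto
      also have "\<theta> * c / 2 * (1 - (1 / 2) ^ Suc K) \<le> \<theta> * c / 2 * 1"
        using \<theta> c by (intro mult_left_mono) auto
      finally show "(\<Sum>l=k..K. \<beta> l) \<le> \<theta> * c / 2" by simp
    qed simp
    finally show ?thesis .
  qed
  \<comment> \<open>\<open>K\<close> bounds levels and times at once, so the windows grow with
    \<open>K\<close> and exhaust the observations after time \<open>n k\<close>, while
    \<open>C k K\<close> decreases.\<close>
  define C where "C k K = {x \<in> X. \<not> coverable X T (n k) (\<epsilon> / 4) (exp (real (n k) * a))
      (fiber X T \<delta> (tail_window n K k K) x)}" for k K
  have mass0: "c \<le> m (C k K)" if "k \<le> K" for k K
  proof -
    have nk: "0 < n k" using n_large[of k] by simp
    have "real (n k) * b \<le> ln 2 + real (n k) * (a + \<theta>) +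
      (m (X - (X - C k K)) + (real (n k) * (\<theta> * c / 2) + ln 2) / (real (n k) * \<theta>)) *
      (real (n k) * (ln (real (card (range (q 0)))) + \<bar>a\<bar> + \<theta>))"
    proof (rule entropy_bound_of_coverable_fibers[OF invariant_fa_prob_axioms TX m(2) _ \<epsilon> _ _ nk \<theta> finite_tail_window past_future[OF that]])
      show "\<delta> 0 \<le> \<epsilon> / 4" by (simp add: \<delta>_def)
      show "real (n k) * b \<le> ent m Q" if "finite (range Q)"
        "\<And>x y t. x \<in> X \<Longrightarrow> y \<in> X \<Longrightarrow> Q x = Q y \<Longrightarrow> t < n k \<Longrightarrow> dist ((T ^^ t) x) ((T ^^ t) y) < \<epsilon>"
        for Q :: "'a \<Rightarrow> 'a + (nat \<times> nat \<Rightarrow> nat)"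
      proof (rule lower[rule_format, OF nk that(1)])
        show "close (n k) x y" if "x \<in> X" "y \<in> X" "Q x = Q y" for x y
          unfolding close_def using \<open>\<And>x y t. x \<in> X \<Longrightarrow> y \<in> X \<Longrightarrow> Q x = Q y \<Longrightarrow> t < n k \<Longrightarrow> dist ((T ^^ t) x) ((T ^^ t) y) < \<epsilon>\<close>[OF that]
          by (intro allI impI)
      qed
      show "coverable X T (n k) (\<epsilon> / 4) (exp (real (n k) * a)) (fiber X T \<delta> (tail_window n K k K) x)"
        if "x \<in> X - C k K" for x using that unfolding C_def by blast
    qed (use q(2) in blast)+
    moreover have "X - (X - C k K) = C k K" by (auto simp: C_def)
    ultimately have "real (n k) * b \<le> ln 2 + real (n k) * (a + \<theta>) +
      (m (C k K) + (real (n k) * (\<theta> * c / 2) + ln 2) / (real (n k) * \<theta>)) * (real (n k) * M)"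
      by (simp add: M_def)
    also have "(real (n k) * (\<theta> * c / 2) + ln 2) / (real (n k) * \<theta>) \<le> c"
    proof -
      have "2 / (\<theta> * c) \<le> real (n k)"
        using N0 n_large[of k] \<theta> by (smt (verit) divide_pos_pos of_nat_less_iff)
      then have "2 \<le> real (n k) * (\<theta> * c)" using \<theta> c by (simp add: field_simps)
      moreover have "ln 2 \<le> (1 :: real)" using ln_2_less_1 by simp
      ultimately have "real (n k) * (\<theta> * c / 2) + ln 2 \<le> c * (real (n k) * \<theta>)" by (simp add: algebra_simps)
      then show ?thesis using nk \<theta> by (simp add: pos_divide_le_eq)
    qed
    then have "ln 2 + real (n k) * (a + \<theta>) +
      (m (C k K) + (real (n k) * (\<theta> * c / 2) + ln 2) / (real (n k) * \<theta>)) * (real (n k) * M)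
      \<le> ln 2 + real (n k) * (a + \<theta>) + (m (C k K) + c) * (real (n k) * M)"
      using M by (intro add_left_mono mult_right_mono) auto
    also have "ln 2 \<le> real (n k) * \<theta>"
    proof -
      have "1 / \<theta> \<le> real (n k)"
        using N0 n_large[of k] \<theta> c by (smt (verit) divide_pos_pos mult_pos_pos of_nat_less_iff)
      then have "1 \<le> real (n k) * \<theta>" using \<theta> by (simp add: field_simps)
      then show ?thesis using ln_2_less_1 by simp
    qed
    finally have "real (n k) * b \<le> real (n k) * (a + 2 * \<theta> + (m (C k K) + c) * M)"
      by (simp add: algebra_simps)
    then have "b \<le> a + 2 * \<theta> + (m (C k K) + c) * M" using nk by simp
    moreover have "c * M = \<theta>" using M by (simp add: c_def)
    moreover have "b = a + 4 * \<theta>" by (simp add: \<theta>_def field_simps)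
    ultimately have "\<theta> \<le> m (C k K) * M" by (simp add: algebra_simps)
    then show ?thesis using M by (simp add: c_def field_simps)
  qed
  have anti: "C k K' \<subseteq> C k K" if "K \<le> K'" for k K K'
  proof
    fix x assume x: "x \<in> C k K'"
    have "fiber X T \<delta> (tail_window n K' k K') x \<subseteq> fiber X T \<delta> (tail_window n K k K) x"
      using that unfolding fiber_def tail_window_def by fastforce
    then have "coverable X T (n k) (\<epsilon> / 4) (exp (real (n k) * a)) (fiber X T \<delta> (tail_window n K' k K') x)"
      if "coverable X T (n k) (\<epsilon> / 4) (exp (real (n k) * a)) (fiber X T \<delta> (tail_window n K k K) x)"
      using that unfolding coverable_def by (meson subsetD)
    then show "x \<in> C k K" using x unfolding C_def by blast
  qed
  \<comment> \<open>For \<open>K < k\<close> the bound is inherited from the smaller set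
    \<open>C k k\<close>.\<close>
  have mass: "c \<le> m (C k K)" for k K
    using mass0[of k "max k K"] mono[OF anti[of K "max k K" k]] by simp
  have closed: "closed (C k K)" for k K
    unfolding closed_sequential_limits
  proof (intro allI impI, elim conjE)
    fix \<xi> x assume \<xi>: "\<forall>j. \<xi> j \<in> C k K" and lim: "\<xi> \<longlonglongrightarrow> x"
    have "\<xi> j \<in> X" for j using \<xi> unfolding C_def by blast
    have "x \<in> X" using closed_sequentially[OF compact_imp_closed[OF X] \<open>\<And>j. \<xi> j \<in> X\<close> lim] .
    moreover have "\<not> coverable X T (n k) (\<epsilon> / 4) (exp (real (n k) * a)) (fiber X T \<delta> (tail_window n K k K) x)"
    proof (rule not_coverable_limit[OF X T TX \<open>\<And>j. \<xi> j \<in> X\<close> lim, where Y = "\<lambda>_. tail_window n K k K" and \<delta> = \<delta>])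
      show "\<not> coverable X T (n k) (\<epsilon> / 4) (exp (real (n k) * a)) (fiber X T \<delta> (tail_window n K k K) (\<xi> j))" for j
        using \<xi> unfolding C_def by blast
      show "y \<in> fiber X T \<delta> (tail_window n K k K) x"
        if "y \<in> X" "\<And>i t. eventually (\<lambda>_ :: nat. (i, t) \<in> tail_window n K k K) sequentially \<Longrightarrow> dist ((T ^^ t) x) ((T ^^ t) y) \<le> \<delta> i"
        for y using that unfolding fiber_def by auto
    qed
    ultimately show "x \<in> C k K" unfolding C_def by blast
  qed
  have sub: "C k K \<subseteq> X" for k K unfolding C_def by blast
  obtain x where x: "\<And>j. \<exists>k\<ge>j. \<forall>K. x \<in> C k K"
    using exists_mem_infinitely_many[of m X c C, OF m(1) X c closed sub anti mass] by blast
  have xX: "x \<in> X" using x[of 0] unfolding C_def by blast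
  have step: "\<not> coverable X T (n k) (\<epsilon> / 4) (exp (real (n k) * a)) (stable_set X T x)" if "\<forall>K. x \<in> C k K" for k
  proof (rule not_coverable_limit[OF X T TX _ tendsto_const, where Y = "\<lambda>K. tail_window n K k K" and \<delta> = \<delta>])
    show "\<not> coverable X T (n k) (\<epsilon> / 4) (exp (real (n k) * a)) (fiber X T \<delta> (tail_window n K k K) x)" for K
      using that unfolding C_def by blast
    fix y assume y: "y \<in> X" and d: "\<And>i t. eventually (\<lambda>K. (i, t) \<in> tail_window n K k K) sequentially \<Longrightarrow> dist ((T ^^ t) x) ((T ^^ t) y) \<le> \<delta> i"
    \<comment> \<open>Such a pair belongs to every window with \<open>K\<close> above both
      \<open>i\<close> and \<open>t\<close>.\<close>
    have d': "dist ((T ^^ t) x) ((T ^^ t) y) \<le> \<delta> i" if "n i \<le> t" "n k \<le> t" for i t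
    proof (rule d, rule eventually_mono[OF eventually_gt_at_top[of "max i t"]])
      show "(i, t) \<in> tail_window n K k K" if "max i t < K" for K
        using that \<open>n i \<le> t\<close> \<open>n k \<le> t\<close> by (simp add: tail_window_def)
    qed
    have "(\<lambda>t. dist ((T ^^ t) x) ((T ^^ t) y)) \<longlonglongrightarrow> 0"
    proof (rule LIMSEQ_I)
      fix r :: real assume r: "0 < r"
      obtain i :: nat where i: "\<epsilon> / 4 / r < real i" using reals_Archimedean2 by blast
      have "\<epsilon> / 4 < r * (real i + 1)" using i r by (simp add: field_simps)
      then have "\<delta> i < r" unfolding \<delta>_def by (subst pos_divide_less_eq) simp_all
      then have "norm (dist ((T ^^ t) x) ((T ^^ t) y) - 0) < r" if "max (n i) (n k) \<le> t" for t
        using d'[of i t] that by simp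
      then show "\<exists>no. \<forall>t\<ge>no. norm (dist ((T ^^ t) x) ((T ^^ t) y) - 0) < r" by blast
    qed
    then show "y \<in> stable_set X T x" using y by (simp add: stable_set_def)
  qed (rule xX)
  have "\<exists>\<^sub>F N in sequentially. \<not> coverable X T N (\<epsilon> / 4) (exp (real N * a)) (stable_set X T x)"
    unfolding frequently_sequentially
  proof
    fix j
    obtain k where k: "j \<le> k" "\<forall>K. x \<in> C k K" using x by blast
    have "k \<le> n k" by (rule strict_mono_imp_increasing[OF n(1)])
    then show "\<exists>N\<ge>j. \<not> coverable X T N (\<epsilon> / 4) (exp (real N * a)) (stable_set X T x)"
      using k(1) step[OF k(2)] by (intro exI[of _ "n k"]) simp
  qed
  then show ?thesis using xX by blast
qed

text \<open>If the inequality failed, rates \<open>a < b\<close> would fit strictly between the two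
  sides; minimal spanning sets then make every stable set coverable at rate \<open>a\<close> for all
  large \<open>n\<close>, against \<open>stable_set_coverable_fails\<close>.\<close>

lemma h_top_le_SUP_stable_set:
  fixes X :: "'a::metric_space set"
  assumes X: "compact X" and ne: "X \<noteq> {}" and T: "continuous_on X T" and TX: "T ` X \<subseteq> X" and \<epsilon>: "0 < \<epsilon>"
  shows "h_top X T X \<epsilon> \<le> (SUP x\<in>X. h_top X T (stable_set X T x) (\<epsilon> / 4))"
proof (rule ccontr)
  assume "\<not> ?thesis"
  then have "(SUP x\<in>X. h_top X T (stable_set X T x) (\<epsilon> / 4)) < h_top X T X \<epsilon>" by simp
  then obtain b where b: "(SUP x\<in>X. h_top X T (stable_set X T x) (\<epsilon> / 4)) < ereal b" "ereal b < h_top X T X \<epsilon>"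
    using ereal_dense2 by blast
  obtain a where a: "(SUP x\<in>X. h_top X T (stable_set X T x) (\<epsilon> / 4)) < ereal a" "ereal a < ereal b"
    using ereal_dense2[OF b(1)] by blast
  have "a < b" using a(2) by simp
  from stable_set_coverable_fails[OF X ne T TX \<epsilon> b(2) this]
  obtain x where x: "x \<in> X"
    "\<exists>\<^sub>F n in sequentially. \<not> coverable X T n (\<epsilon> / 4) (exp (real n * a)) (stable_set X T x)" by blast
  have "h_top X T (stable_set X T x) (\<epsilon> / 4) \<le> (SUP x\<in>X. h_top X T (stable_set X T x) (\<epsilon> / 4))"
    by (rule SUP_upper[OF x(1)])
  then have "h_top X T (stable_set X T x) (\<epsilon> / 4) < ereal a" using a(1) by (rule le_less_trans)
  then have "eventually (\<lambda>n. ereal (ln (real (spanning_number X T (stable_set X T x) n (\<epsilon> / 4))) / real n) < ereal a) sequentially"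
    unfolding h_top_def by (rule Limsup_lessD)
  with eventually_gt_at_top[of "0 :: nat"]
  have "eventually (\<lambda>n. coverable X T n (\<epsilon> / 4) (exp (real n * a)) (stable_set X T x)) sequentially"
  proof eventually_elim
    fix n :: nat
    assume n: "0 < n" and "ereal (ln (real (spanning_number X T (stable_set X T x) n (\<epsilon> / 4))) / real n) < ereal a"
    then have less: "ln (real (spanning_number X T (stable_set X T x) n (\<epsilon> / 4))) < real n * a"
      by (simp add: field_simps)
    have sub: "stable_set X T x \<subseteq> X" by (auto simp: stable_set_def)
    have e4: "0 < \<epsilon> / 4" using \<epsilon> by simp
    obtain E where E: "finite E" "card E = spanning_number X T (stable_set X T x) n (\<epsilon> / 4)"
      "spanning X T (stable_set X T x) n (\<epsilon> / 4) E"
      using exists_finite_spanning[OF X TX sub n e4] by blast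
    have "real (card E) \<le> exp (real n * a)"
    proof (cases "card E = 0")
      case False
      then show ?thesis using less E(2) by (metis exp_less_mono exp_ln less_eq_real_def of_nat_0_less_iff gr0I)
    qed simp
    then show "coverable X T n (\<epsilon> / 4) (exp (real n * a)) (stable_set X T x)"
      using E(1,3) unfolding coverable_def spanning_def bowen_dist_less_iff[OF n] by (intro exI[of _ E]) simp
  qed
  then show False using x(2) by (simp add: frequently_def)
qed

section \<open>Comparison of the two upper limits as the scale tends to 0\<close>

lemma h_top_mono:
  fixes X :: "'a::metric_space set"
  assumes X: "compact X" and TX: "T ` X \<subseteq> X" and Z: "Z \<subseteq> Z'" "Z' \<subseteq> X" "Z \<noteq> {}" and \<epsilon>: "0 < \<epsilon>"
  shows "h_top X T Z \<epsilon> \<le> h_top X T Z' \<epsilon>"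
  unfolding h_top_def
proof (rule Limsup_mono, rule eventually_mono[OF eventually_gt_at_top[of 0]])
  fix n :: nat assume n: "0 < n"
  have ZX: "Z \<subseteq> X" using Z by blast
  obtain E where E: "finite E" "card E = spanning_number X T Z n \<epsilon>" "spanning X T Z n \<epsilon> E"
    using exists_finite_spanning[OF X TX ZX n \<epsilon>] by blast
  obtain E' where E': "finite E'" "card E' = spanning_number X T Z' n \<epsilon>" "spanning X T Z' n \<epsilon> E'"
    using exists_finite_spanning[OF X TX Z(2) n \<epsilon>] by blast
  have "spanning X T Z n \<epsilon> E'" using E'(3) Z(1) unfolding spanning_def by blast
  then have le: "spanning_number X T Z n \<epsilon> \<le> spanning_number X T Z' n \<epsilon>"
    using spanning_number_least[OF E'(1)] E'(2) by metis
  have "E \<noteq> {}" using E(3) Z(3) unfolding spanning_def by blast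
  then have "0 < spanning_number X T Z n \<epsilon>" using E by (metis card_gt_0_iff)
  then show "ereal (ln (real (spanning_number X T Z n \<epsilon>)) / real n) \<le> ereal (ln (real (spanning_number X T Z' n \<epsilon>)) / real n)"
    using le by (simp add: divide_right_mono)
qed

theorem theorem1p5:
  fixes X :: "'a::metric_space set" and T :: "'a \<Rightarrow> 'a"
  assumes "compact X" and "X \<noteq> {}"
    and "continuous_on X T" and "T ` X = X"
  shows "upper_mdim X T X =
    Limsup (at_right 0)
      (\<lambda>\<delta>. ereal (1 / ln (1 / \<delta>)) * (SUP x\<in>X. h_top X T (stable_set X T x) \<delta>))"
proof (rule antisym)
  define S where "S \<delta> = (SUP x\<in>X. h_top X T (stable_set X T x) \<delta>)" for \<delta>
  have TX: "T ` X \<subseteq> X" using assms(4) by simp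
  have S_le: "S \<delta> \<le> h_top X T X \<delta>" if "0 < \<delta>" for \<delta>
    unfolding S_def
  proof (rule SUP_least)
    fix x assume x: "x \<in> X"
    have "x \<in> stable_set X T x" using x by (simp add: stable_set_def)
    then show "h_top X T (stable_set X T x) \<delta> \<le> h_top X T X \<delta>"
      by (intro h_top_mono[OF assms(1) TX _ order_refl _ that]) (auto simp: stable_set_def)
  qed
  have le_S: "h_top X T X \<delta> \<le> S (\<delta> / 4)" if "0 < \<delta>" for \<delta>
    unfolding S_def by (rule h_top_le_SUP_stable_set[OF assms(1-3) TX that])
  have div: "h / ereal l = ereal (1 / l) * h" if "0 < l" for h l
    using that by (cases h) (auto simp: divide_ereal_def inverse_eq_divide mult.commute)
  have ln_large: "\<forall>\<^sub>F \<epsilon> in at_right 0. 0 < \<epsilon> \<and> k < ln (1 / \<epsilon>)" for k :: real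
    unfolding eventually_at_right_field
  proof (intro exI[of _ "exp (- k)"] conjI allI impI)
    fix \<epsilon> :: real assume "0 < \<epsilon>" "\<epsilon> < exp (- k)"
    then have "ln \<epsilon> < - k" using ln_less_cancel_iff[of \<epsilon> "exp (- k)"] by simp
    then show "k < ln (1 / \<epsilon>)" using \<open>0 < \<epsilon>\<close> by (simp add: ln_div)
  qed auto
  show "Limsup (at_right 0) (\<lambda>\<delta>. ereal (1 / ln (1 / \<delta>)) * (SUP x\<in>X. h_top X T (stable_set X T x) \<delta>))
      \<le> upper_mdim X T X"
    unfolding upper_mdim_def S_def[symmetric]
  proof (rule Limsup_mono, rule eventually_mono[OF ln_large[of 0]], elim conjE)
    fix \<delta> :: real assume d: "0 < \<delta>" "0 < ln (1 / \<delta>)"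
    show "ereal (1 / ln (1 / \<delta>)) * S \<delta> \<le> h_top X T X \<delta> / ereal (ln (1 / \<delta>))"
      unfolding div[OF d(2)] using d S_le[OF d(1)] by (intro ereal_mult_left_mono) auto
  qed
  show "upper_mdim X T X
      \<le> Limsup (at_right 0) (\<lambda>\<delta>. ereal (1 / ln (1 / \<delta>)) * (SUP x\<in>X. h_top X T (stable_set X T x) \<delta>))"
  proof (rule ccontr)
    assume "\<not> ?thesis"
    then have "Limsup (at_right 0) (\<lambda>\<delta>. ereal (1 / ln (1 / \<delta>)) * S \<delta>) < upper_mdim X T X"
      unfolding S_def not_le .
    then obtain y where y: "Limsup (at_right 0) (\<lambda>\<delta>. ereal (1 / ln (1 / \<delta>)) * S \<delta>) < ereal y"
        "ereal y < upper_mdim X T X"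
      using ereal_dense2 by blast
    obtain z where z: "Limsup (at_right 0) (\<lambda>\<delta>. ereal (1 / ln (1 / \<delta>)) * S \<delta>) < ereal z" "z < y"
      using ereal_dense2[OF y(1)] by auto
    have "\<forall>\<^sub>F \<delta> in at_right 0. ereal (1 / ln (1 / \<delta>)) * S \<delta> < ereal z"
      using z(1) by (rule Limsup_lessD)
    then obtain r where r: "0 < r" "\<And>\<delta>. 0 < \<delta> \<Longrightarrow> \<delta> < r \<Longrightarrow> ereal (1 / ln (1 / \<delta>)) * S \<delta> < ereal z"
      unfolding eventually_at_right_field by blast
    have "\<forall>\<^sub>F \<epsilon> in at_right 0. 0 < \<epsilon> \<and> \<epsilon> < r"
      unfolding eventually_at_right_field using r(1) by blast
    then have "\<forall>\<^sub>F \<epsilon> in at_right 0. h_top X T X \<epsilon> / ereal (ln (1 / \<epsilon>)) \<le> ereal y"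
      \<comment> \<open>This threshold yields \<open>z * (ln (1 / \<epsilon>) + ln 4) \<le> y * ln
        (1 / \<epsilon>)\<close>: the room between \<open>z\<close> and \<open>y\<close> pays for
        the \<open>ln 4\<close> caused by the change of scale from \<open>\<epsilon>\<close> to
        \<open>\<epsilon> / 4\<close>.\<close>
      using ln_large[of "max 0 (z * ln 4 / (y - z))"]
    proof eventually_elim
      fix \<epsilon> :: real
      assume e: "0 < \<epsilon> \<and> \<epsilon> < r" and "0 < \<epsilon> \<and> max 0 (z * ln 4 / (y - z)) < ln (1 / \<epsilon>)"
      then have l: "0 < ln (1 / \<epsilon>)" "z * ln 4 < ln (1 / \<epsilon>) * (y - z)"
        using z(2) by (simp_all add: pos_divide_less_eq)
      have l4: "ln (1 / (\<epsilon> / 4)) = ln (1 / \<epsilon>) + ln 4" using e by (simp add: ln_div)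
      have "0 < ln (4 :: real)" by simp
      then have pos: "0 < ln (1 / (\<epsilon> / 4))" using l(1) unfolding l4 by linarith
      have "ereal (1 / ln (1 / (\<epsilon> / 4))) * S (\<epsilon> / 4) < ereal z" using e by (intro r(2)) auto
      then have "S (\<epsilon> / 4) \<le> ereal (z * ln (1 / (\<epsilon> / 4)))"
        using pos by (cases "S (\<epsilon> / 4)") (auto simp: field_simps)
      also have "\<dots> \<le> ereal (y * ln (1 / \<epsilon>))"
        using l(2) unfolding l4 by (simp add: algebra_simps)
      finally have "h_top X T X \<epsilon> \<le> ereal (y * ln (1 / \<epsilon>))" using le_S e order_trans by blast
      then have "ereal (1 / ln (1 / \<epsilon>)) * h_top X T X \<epsilon> \<le> ereal (1 / ln (1 / \<epsilon>)) * ereal (y * ln (1 / \<epsilon>))"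
        using l(1) by (intro ereal_mult_left_mono) auto
      then show "h_top X T X \<epsilon> / ereal (ln (1 / \<epsilon>)) \<le> ereal y"
        unfolding div[OF l(1)] using l(1) by simp
    qed
    then have "upper_mdim X T X \<le> ereal y" unfolding upper_mdim_def by (rule Limsup_bounded)
    then show False using y(2) by simp
  qed
qed

end
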